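(* Let $n=2k$ be even and let $(F_1,F_2,F_3,F_4)$ be a cyclically ordered quadruple of oriented flags in $\mathrm{Flag}^+(\mathbb{R}^n)$. Then the open halfspaces $\mathcal{H}(F_1,F_2)$ and $\mathcal{H}(F_3,F_4)$ in $\mathbb{RP}^{n-1}$ are disjoint.
   Context: Oriented flags ($n=2k$). $\mathbb{R}^n$ has its standard orientation. Consider complete flags $F^{(1)}\subset\dots\subset F^{(n-1)}$ in $\mathbb{R}^n$ ($\dim F^{(i)}=i$) with a choice of orientation on each $F^{(i)}$. As $n$ is even, $\mathrm{Flag}^+(\mathbb{R}^n)$ is the quotient of the set of these by simultaneously reversing the orientations of all odd-dimensional $F^{(i)}$; an oriented flag before passing to this quotient is called a lift. Direct sums of oriented subspaces are oriented by concatenating positive bases in order; $F^{(0)}=\{0\}$. A triple $(F_1,F_2,F_3)$ is hyperconvex if there are lifts with $\widehat F_1^{(i_1)}\oplus \widehat F_2^{(i_2)}\oplus \widehat F_3^{(i_3)}=\mathbb{R}^n$ as oriented vector spaces for all integers $0\le i_1,i_2,i_3\le n-1$ with $i_1+i_2+i_3=n$; hyperconvexity is a partial cyclic order. A quadruple $(F_1,F_2,F_3,F_4)$ is cyclically ordered if $(F_i,F_j,F_l)$ is hyperconvex for all $i<j<l$. A pair $(F_1,F_2)$ is oriented transverse if there are lifts with $\widehat F_1^{(i)}\oplus\widehat F_2^{(n-i)}=\mathbb{R}^n$ as oriented spaces for $1\le i\le n-1$. For an oriented transverse pair there is a positively oriented ordered basis $\mathcal{E}=(e_1,\dots,e_n)$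 of $\mathbb{R}^n$, unique up to positive scaling of the basis vectors (and global sign), such that $F_1$ is the class of the oriented flag with $i$-th space $\mathrm{span}(e_1,\dots,e_i)$ and $F_2$ the class of the oriented flag with $i$-th space $\mathrm{span}(e_{n-i+1},\dots,e_n)$, each span oriented by the listed order; $\mathcal{E}$ is called adapted to $(F_1,F_2)$. Halfspaces. For $v\neq 0$, $S^+_{\mathcal{E}}(v)$ is the maximal number of sign changes in the sequence of coordinates of $v$ in the basis $\mathcal{E}$, over all ways of assigning signs to zero coordinates. For an oriented transverse pair with adapted basis $\mathcal{E}$, $\mathcal{H}(F_1,F_2)=\{[v]\in\mathbb{RP}^{n-1}: S^+_{\mathcal{E}}(v)\le k-1\}$. *)

theory Defs
  imports "Jordan_Normal_Form.VS_Connect"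
begin

text \<open>
  \<open>\<real>\<^sup>n\<close> is \<^term>\<open>carrier_vec n :: real vec set\<close>. Lists of vectors play the role of ordered
  systems of vectors, and \<^term>\<open>mat_of_cols n bs\<close> is the matrix whose columns they are.
\<close>

definition vspan :: "nat \<Rightarrow> real vec set \<Rightarrow> real vec set" where
  "vspan n S = LinearCombinations.module.span class_ring (module_vec TYPE(real) n) S"

definition independent_list :: "nat \<Rightarrow> real vec list \<Rightarrow> bool" where
  "independent_list n bs \<longleftrightarrow> set bs \<subseteq> carrier_vec n \<and> distinct bs \<and>
     \<not> LinearCombinations.module.lin_dep class_ring (module_vec TYPE(real) n) (set bs)"

text \<open>
  \<open>base_change n bs A cs\<close>: the vectors \<open>cs\<close> are obtained from \<open>bs\<close> by the square matrix \<open>A\<close>.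
  For independent \<open>bs\<close> and invertible \<open>A\<close> this says that \<open>bs\<close> and \<open>cs\<close> are ordered bases of the
  same subspace, with transition matrix \<open>A\<close>.
\<close>

definition base_change :: "nat \<Rightarrow> real vec list \<Rightarrow> real mat \<Rightarrow> real vec list \<Rightarrow> bool" where
  "base_change n bs A cs \<longleftrightarrow>
     set cs \<subseteq> carrier_vec n \<and> A \<in> carrier_mat (length bs) (length bs) \<and>
     mat_of_cols n cs = mat_of_cols n bs * A"

text \<open>
  An oriented subspace is encoded by the set of all its positively oriented ordered bases; the
  underlying subspace is the span of any of them. The zero space only carries the
  orientation \<^term>\<open>{[]}\<close>, the neutral element for oriented direct sums.
\<close>

type_synonym oriented_subspace = "real vec list set"

definition orientation :: "nat \<Rightarrow> real vec list \<Rightarrow> oriented_subspace" where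
  "orientation n bs = {cs. \<exists>A. base_change n bs A cs \<and> det A > 0}"

definition oriented_subspaces :: "nat \<Rightarrow> nat \<Rightarrow> oriented_subspace set" where
  "oriented_subspaces n d = {orientation n bs | bs. independent_list n bs \<and> length bs = d}"

definition underlying_space :: "nat \<Rightarrow> oriented_subspace \<Rightarrow> real vec set" where
  "underlying_space n V = (\<Union>bs\<in>V. vspan n (set bs))"

definition reverse_orientation :: "nat \<Rightarrow> oriented_subspace \<Rightarrow> oriented_subspace" where
  "reverse_orientation n V = {cs. \<exists>bs\<in>V. \<exists>A. base_change n bs A cs \<and> det A < 0}"

definition standard_orientation :: "nat \<Rightarrow> oriented_subspace" where
  "standard_orientation n = orientation n (unit_vecs n)"

text \<open>The oriented direct sum; it is the empty set (no oriented subspace) if the sum is not direct.\<close>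

definition oriented_sum :: "nat \<Rightarrow> oriented_subspace \<Rightarrow> oriented_subspace \<Rightarrow> oriented_subspace" where
  "oriented_sum n V W =
     {ds. \<exists>bs\<in>V. \<exists>cs\<in>W. independent_list n (bs @ cs) \<and> ds \<in> orientation n (bs @ cs)}"

text \<open>
  An oriented flag maps \<open>i < n\<close> to its \<open>i\<close>-dimensional oriented space (for \<open>i = 0\<close> necessarily the
  zero space). The value \<^term>\<open>{}\<close> at \<open>i \<ge> n\<close> is a dummy that makes the representation unique.
\<close>

type_synonym oriented_flag = "nat \<Rightarrow> oriented_subspace"

definition oriented_flags :: "nat \<Rightarrow> oriented_flag set" where
  "oriented_flags n = {F.
     (\<forall>i<n. F i \<in> oriented_subspaces n i) \<and>
     (\<forall>i j. i \<le> j \<and> j < n \<longrightarrow> underlying_space n (F i) \<subseteq> underlying_space n (F j)) \<and>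
     (\<forall>i\<ge>n. F i = {})}"

definition reverse_odd :: "nat \<Rightarrow> oriented_flag \<Rightarrow> oriented_flag" where
  "reverse_odd n F = (\<lambda>i. if odd i then reverse_orientation n (F i) else F i)"

definition flag_rel :: "nat \<Rightarrow> (oriented_flag \<times> oriented_flag) set" where
  "flag_rel n = {(F, G). F \<in> oriented_flags n \<and> G \<in> oriented_flags n \<and>
                         (G = F \<or> G = reverse_odd n F)}"

text \<open>
  This is the quotient used for even \<open>n\<close>. The elements of \<^term>\<open>flag_plus n\<close> are equivalence
  classes, so the lifts of \<open>F\<close> are exactly the elements of \<open>F\<close>.
\<close>

definition flag_plus :: "nat \<Rightarrow> oriented_flag set set" ("Flag\<^sup>+") where
  "Flag\<^sup>+ n = oriented_flags n // flag_rel n"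

definition hyperconvex ::
    "nat \<Rightarrow> oriented_flag set \<Rightarrow> oriented_flag set \<Rightarrow> oriented_flag set \<Rightarrow> bool" where
  "hyperconvex n F1 F2 F3 \<longleftrightarrow> (\<exists>G1\<in>F1. \<exists>G2\<in>F2. \<exists>G3\<in>F3. \<forall>i1 i2 i3.
     i1 \<le> n - 1 \<and> i2 \<le> n - 1 \<and> i3 \<le> n - 1 \<and> i1 + i2 + i3 = n \<longrightarrow>
     oriented_sum n (oriented_sum n (G1 i1) (G2 i2)) (G3 i3) = standard_orientation n)"

definition cyclically_ordered ::
    "nat \<Rightarrow> oriented_flag set \<Rightarrow> oriented_flag set \<Rightarrow> oriented_flag set \<Rightarrow> oriented_flag set \<Rightarrow> bool"
  where
  "cyclically_ordered n F1 F2 F3 F4 \<longleftrightarrow> (let F = [F1, F2, F3, F4] in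
     \<forall>i j l. i < j \<and> j < l \<and> l < 4 \<longrightarrow> hyperconvex n (F ! i) (F ! j) (F ! l))"

definition initial_flag :: "nat \<Rightarrow> real vec list \<Rightarrow> oriented_flag" where
  "initial_flag n E = (\<lambda>i. if i < n then orientation n (take i E) else {})"

definition final_flag :: "nat \<Rightarrow> real vec list \<Rightarrow> oriented_flag" where
  "final_flag n E = (\<lambda>i. if i < n then orientation n (drop (n - i) E) else {})"

definition adapted :: "nat \<Rightarrow> real vec list \<Rightarrow> oriented_flag set \<Rightarrow> oriented_flag set \<Rightarrow> bool" where
  "adapted n E F1 F2 \<longleftrightarrow>
     E \<in> standard_orientation n \<and> initial_flag n E \<in> F1 \<and> final_flag n E \<in> F2"

definition coordinates :: "nat \<Rightarrow> real vec list \<Rightarrow> real vec \<Rightarrow> real list" where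
  "coordinates n E v = list_of_vec (THE x. x \<in> carrier_vec n \<and> mat_of_cols n E *\<^sub>v x = v)"

definition sign_changes :: "real list \<Rightarrow> nat" where
  "sign_changes s = card {i. Suc i < length s \<and> s ! i * s ! Suc i < 0}"

definition sign_assignments :: "real list \<Rightarrow> real list set" where
  "sign_assignments xs = {s. length s = length xs \<and>
     (\<forall>i<length xs. s ! i \<in> {1, -1} \<and> (xs ! i \<noteq> 0 \<longrightarrow> s ! i = sgn (xs ! i)))}"

definition S_plus :: "nat \<Rightarrow> real vec list \<Rightarrow> real vec \<Rightarrow> nat" where
  "S_plus n E v = Max (sign_changes ` sign_assignments (coordinates n E v))"

definition projective_class :: "real vec \<Rightarrow> real vec set" where
  "projective_class v = {c \<cdot>\<^sub>v v | c. c \<noteq> 0}"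

text \<open>
  An adapted basis of an oriented transverse pair is unique up to positive scaling of its vectors
  and a global sign, neither of which affects \<^const>\<open>S_plus\<close>; so the existential quantifier
  over \<open>E\<close> makes no choice. Only oriented transverse pairs have an adapted basis: its initial and
  final flags are lifts whose complementary spaces add up to the oriented \<open>\<real>\<^sup>n\<close>.
\<close>

definition halfspace :: "nat \<Rightarrow> oriented_flag set \<Rightarrow> oriented_flag set \<Rightarrow> real vec set set" where
  "halfspace n F1 F2 = {projective_class v | v. v \<in> carrier_vec n \<and> v \<noteq> 0\<^sub>v n \<and>
     (\<exists>E. adapted n E F1 F2 \<and> S_plus n E v \<le> n div 2 - 1)}"

end

theory Submission
  imports Defs
begin

text \<open>
  Let \<open>E\<close> and \<open>E'\<close> be bases adapted to \<open>(F1, F2)\<close> and \<open>(F3, F4)\<close>, and let \<open>a\<close> and \<open>b\<close> be the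
  coordinates of one vector in these bases, so that \<open>a = C b\<close> for the transition matrix \<open>C\<close>. If the
  vector spanned a point of both halfspaces, both coordinate vectors would have at most
  \<open>n/2 - 1\<close> sign changes. The proof shows that their numbers of sign changes add up to at least
  \<open>n - 1\<close>, which is a contradiction.

  Geometrically, \<open>\<H>(F1, F2) \<subseteq> \<H>(F1, F3)\<close> because \<open>(F1, F2, F3)\<close> is hyperconvex, and
  \<open>\<H>(F3, F4) \<subseteq> \<H>(F3, F1)\<close> because \<open>(F3, F4, F1)\<close> is, and \<open>\<H>(F1, F3)\<close> and \<open>\<H>(F3, F1)\<close> are
  visibly disjoint: up to positive scaling and a global sign, a basis adapted to \<open>(F3, F1)\<close> is one
  adapted to \<open>(F1, F3)\<close>, listed backwards and with alternating signs, and this operation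
  exchanges sign changes and sign repetitions.

  For the first inclusion, hyperconvexity of \<open>(F1, F2, F3)\<close> prescribes the signs of all minors of
  \<open>C\<close> on contiguous rows and initial columns (lemma \<open>positive_third_flag_minors\<close>). These signs are
  exactly what makes Neville elimination run with nonnegative multipliers: adding nonnegative multiples
  of each row to the row above it, all entries of \<open>C\<close> above the antidiagonal can be cleared column by
  column (lemma \<open>elimination\<close>). On coordinate vectors these row operations replace \<open>a\<^sub>i\<close> by
  \<open>a\<^sub>i + t a\<^sub>i\<^sub>+\<^sub>1\<close> with \<open>t \<ge> 0\<close>, which cannot create sign changes (lemma
  \<open>max_sign_changes_adjacent_addition\<close>); on bases they replace the adapted basis of \<open>(F1, F2)\<close> by one of
  \<open>(F1, F3)\<close>. The second inclusion is the same argument for the inverse of \<open>C\<close>. Once both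
  eliminations are done, the transition matrix and its inverse both vanish above the antidiagonal, hence
  the transition matrix is antidiagonal, and its entries alternate in sign (lemma
  \<open>sign_changes_complementary\<close>).
\<close>

section \<open>Sign changes of real sequences\<close>

text \<open>
  The number \<open>S\<^sup>+\<close> as a function of the coordinate list alone, so that the coordinates can be
  transformed without reference to a basis.
\<close>

definition max_sign_changes :: "real list \<Rightarrow> nat" where
  "max_sign_changes xs = Max (sign_changes ` sign_assignments xs)"

lemma finite_sign_assignments: "finite (sign_assignments xs)"
proof (rule finite_subset)
  show "sign_assignments xs \<subseteq> {s. set s \<subseteq> {1, -1} \<and> length s = length xs}"
    by (auto simp: sign_assignments_def in_set_conv_nth)
  show "finite {s :: real list. set s \<subseteq> {1, -1} \<and> length s = length xs}"
    by (rule finite_lists_length_eq) simp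
qed

lemma sign_assignments_nonempty: "sign_assignments xs \<noteq> {}"
proof -
  have "map (\<lambda>x. if x = 0 then 1 else sgn x) xs \<in> sign_assignments xs"
    by (auto simp: sign_assignments_def sgn_if)
  then show ?thesis by blast
qed

lemma sign_changes_le_max:
  "s \<in> sign_assignments xs \<Longrightarrow> sign_changes s \<le> max_sign_changes xs"
  unfolding max_sign_changes_def using finite_sign_assignments by (intro Max_ge) auto

lemma max_sign_changes_attained:
  obtains s where "s \<in> sign_assignments xs" "sign_changes s = max_sign_changes xs"
proof -
  have "max_sign_changes xs \<in> sign_changes ` sign_assignments xs"
    unfolding max_sign_changes_def
    using finite_sign_assignments sign_assignments_nonempty by (intro Max_in) auto
  then show ?thesis using that by auto
qed

text \<open>
  Variation diminishing for the elementary step. An admissible sign choice \<open>s\<close> for the new sequence fails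
  to be admissible for the old one only if the \<open>i\<close>-th entry has changed its sign or has become zero. As
  \<open>t \<ge> 0\<close>, this forces the next entry to have the opposite sign of the old \<open>i\<close>-th entry, so
  flipping \<open>s\<close> at \<open>i\<close> gains a sign change between \<open>i\<close> and \<open>i + 1\<close> and loses at most the one between
  \<open>i - 1\<close> and \<open>i\<close>.
\<close>

lemma max_sign_changes_adjacent_addition:
  assumes i: "Suc i < length xs" and t: "t \<ge> 0"
  shows "max_sign_changes (xs[i := xs ! i + t * xs ! Suc i]) \<le> max_sign_changes xs"
proof -
  let ?ys = "xs[i := xs ! i + t * xs ! Suc i]"
  obtain s where s: "s \<in> sign_assignments ?ys" "sign_changes s = max_sign_changes ?ys"
    by (rule max_sign_changes_attained)
  have len: "length s = length xs" using s(1) by (simp add: sign_assignments_def)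
  have sgn_s: "s ! l = 1 \<or> s ! l = -1" if "l < length xs" for l
    using s(1) that by (auto simp: sign_assignments_def)
  have s_eq: "s ! l = sgn (?ys ! l)" if "l < length xs" "?ys ! l \<noteq> 0" for l
    using s(1) that by (simp add: sign_assignments_def)
  show ?thesis
  proof (cases "s \<in> sign_assignments xs")
    case True
    then show ?thesis using s(2) sign_changes_le_max by metis
  next
    case False
    have "\<exists>l<length xs. xs ! l \<noteq> 0 \<and> s ! l \<noteq> sgn (xs ! l)"
      using False sgn_s len by (auto simp: sign_assignments_def)
    then obtain l where l: "l < length xs" "xs ! l \<noteq> 0" "s ! l \<noteq> sgn (xs ! l)" by blast
    have "l = i" using s_eq[of l] l by (cases "l = i") auto
    with l have xi: "xs ! i \<noteq> 0" "s ! i \<noteq> sgn (xs ! i)" by auto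
    have si: "s ! i = - sgn (xs ! i)" using xi sgn_s[of i] i by (auto simp: sgn_if)
    have yi: "?ys ! i = xs ! i + t * xs ! Suc i" using i by simp
    have yi': "?ys ! i = 0 \<or> sgn (?ys ! i) = - sgn (xs ! i)" using s_eq[OF Suc_lessD[OF i]] si by fastforce
    have opp: "xs ! Suc i \<noteq> 0 \<and> sgn (xs ! Suc i) = - sgn (xs ! i)"
    proof (cases "xs ! i > 0")
      case True
      then have "t * xs ! Suc i < 0" using yi yi' by (auto simp: sgn_if split: if_splits)
      then have "xs ! Suc i < 0" using t by (simp add: mult_less_0_iff)
      with True show ?thesis by simp
    next
      case False
      then have neg: "xs ! i < 0" using xi by simp
      then have "t * xs ! Suc i > 0" using yi yi' by (auto simp: sgn_if split: if_splits)
      then have "xs ! Suc i > 0" using t by (simp add: zero_less_mult_iff)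
      with neg show ?thesis by simp
    qed
    have sSi: "s ! Suc i = - sgn (xs ! i)" using s_eq[of "Suc i"] opp i by simp
    define s' where "s' = s[i := sgn (xs ! i)]"
    have s': "s' \<in> sign_assignments xs"
      unfolding sign_assignments_def
    proof (intro CollectI conjI allI impI)
      show "length s' = length xs" by (simp add: s'_def len)
      fix m assume m: "m < length xs"
      show "s' ! m \<in> {1, -1}"
        using sgn_s[OF m] m xi(1) len by (cases "m = i") (auto simp: s'_def sgn_if)
      show "s' ! m = sgn (xs ! m)" if "xs ! m \<noteq> 0"
        using s_eq[OF m] that m len by (cases "m = i") (auto simp: s'_def)
    qed
    let ?ch = "\<lambda>s. {l. Suc l < length s \<and> s ! l * s ! Suc l < (0::real)}"
    have fin: "finite (?ch r)" for r by (rule finite_subset[of _ "{..<length r}"]) auto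
    have sq: "sgn (xs ! i) * sgn (xs ! i) = 1" using xi(1) by (auto simp: sgn_if)
    have in': "i \<in> ?ch s'" using i len sSi sq by (simp add: s'_def)
    have notin: "i \<notin> ?ch s" using si sSi sq by simp
    \<comment> \<open>For \<open>i = 0\<close> truncation makes \<open>i - 1 = i\<close>, and then nothing is removed on the left.\<close>
    have "?ch s - {i - 1} \<subseteq> ?ch s' - {i}"
    proof
      fix l assume l: "l \<in> ?ch s - {i - 1}"
      then have "l \<noteq> i" using notin by blast
      moreover have "Suc l \<noteq> i" using l by auto
      ultimately show "l \<in> ?ch s' - {i}" using l by (simp add: s'_def)
    qed
    then have "card (?ch s - {i - 1}) \<le> card (?ch s' - {i})" using fin by (intro card_mono) auto
    moreover have "card (?ch s) \<le> card (?ch s - {i - 1}) + 1"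
      using card_Diff_singleton_if[of "?ch s" "i - 1"] by (auto split: if_splits)
    moreover have "card (?ch s' - {i}) + 1 = card (?ch s')"
      using card_Suc_Diff1[OF fin in'] by simp
    ultimately have "sign_changes s \<le> sign_changes s'" unfolding sign_changes_def by linarith
    then show ?thesis using s(2) sign_changes_le_max[OF s'] by linarith
  qed
qed

text \<open>
  A bidiagonal transformation consists of elementary steps, performed from the first position on: the step
  at \<open>i\<close> adds a multiple of an entry that has not been modified yet.
\<close>

lemma max_sign_changes_bidiagonal:
  assumes "m < n" and t: "\<And>i. i < m \<Longrightarrow> t i \<ge> 0"
  shows "max_sign_changes (map (\<lambda>i. if i < m then f i + t i * f (Suc i) else f i) [0..<n])
    \<le> max_sign_changes (map f [0..<n])"
  using assms
proof (induction m)
  case 0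
  then show ?case by simp
next
  case (Suc m)
  let ?g = "\<lambda>m i. if i < m then f i + t i * f (Suc i) else f i"
  let ?xs = "map (?g m) [0..<n]"
  have "map (?g (Suc m)) [0..<n] = ?xs[m := ?xs ! m + t m * ?xs ! Suc m]"
    using Suc.prems(1) by (intro nth_equalityI) (auto simp: nth_list_update)
  moreover have "max_sign_changes (?xs[m := ?xs ! m + t m * ?xs ! Suc m]) \<le> max_sign_changes ?xs"
    using Suc.prems by (intro max_sign_changes_adjacent_addition) auto
  ultimately show ?case using Suc.IH Suc.prems by simp
qed

text \<open>
  Alternating all signs turns sign changes into sign repetitions, while reversal preserves both; so a sign
  choice for \<open>ys\<close> and the corresponding one for \<open>xs\<close> together have exactly one sign change for each of
  the \<open>n - 1\<close> pairs of neighbours. The factor \<open>d\<close> leaves the sign with which the alternation starts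
  open.
\<close>

lemma max_sign_changes_reversed:
  assumes len: "length xs = n" "length ys = n"
    and xy: "\<And>i. i < n \<Longrightarrow> xs ! (n - 1 - i) = z i * ys ! i"
    and z: "\<And>i. i < n \<Longrightarrow> d * (-1) ^ i * z i > 0"
  shows "n - 1 \<le> max_sign_changes xs + max_sign_changes ys"
proof (cases "n = 0")
  case False
  obtain s where s: "s \<in> sign_assignments ys" "sign_changes s = max_sign_changes ys"
    by (rule max_sign_changes_attained)
  have lens: "length s = n" using s(1) len by (simp add: sign_assignments_def)
  have sgn_s: "s ! l = 1 \<or> s ! l = -1" if "l < n" for l
    using s(1) that len by (auto simp: sign_assignments_def)
  have "d \<noteq> 0" using z[of 0] False by auto
  then have sgnd: "sgn d * sgn d = 1" "sgn d = 1 \<or> sgn d = -1" by (auto simp: sgn_if)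
  define r where "r = map (\<lambda>i. sgn d * (-1) ^ (n - 1 - i) * s ! (n - 1 - i)) [0..<n]"
  have r: "r ! i = sgn d * (-1) ^ (n - 1 - i) * s ! (n - 1 - i)" if "i < n" for i
    using that by (simp add: r_def)
  have lenr: "length r = n" by (simp add: r_def)
  have pm: "(-1::real) ^ i = 1 \<or> (-1::real) ^ i = -1" for i by (cases "even i") auto
  have "r \<in> sign_assignments xs"
    unfolding sign_assignments_def
  proof (intro CollectI conjI allI impI)
    show "length r = length xs" by (simp add: r_def len)
    fix i assume "i < length xs"
    then have i: "i < n" by (simp add: len)
    let ?j = "n - 1 - i"
    have j: "?j < n" "n - 1 - ?j = i" using i by auto
    show "r ! i \<in> {1, -1}" using r[OF i] sgn_s[OF j(1)] sgnd(2) pm[of ?j] by auto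
    assume nz: "xs ! i \<noteq> 0"
    have xi: "xs ! i = z ?j * ys ! ?j" using xy[OF j(1)] j(2) by simp
    then have "ys ! ?j \<noteq> 0" using nz by auto
    then have "s ! ?j = sgn (ys ! ?j)" using s(1) j(1) len by (simp add: sign_assignments_def)
    moreover have "sgn (z ?j) = sgn d * (-1) ^ ?j"
    proof -
      have "sgn (d * (-1) ^ ?j * z ?j) = 1" using z[OF j(1)] by simp
      then have "sgn d * (-1) ^ ?j * sgn (z ?j) = 1" by (simp add: sgn_mult power_sgn)
      then show ?thesis using sgnd(2) pm[of ?j] by auto
    qed
    ultimately show "r ! i = sgn (xs ! i)" using r[OF i] xi by (simp add: sgn_mult)
  qed
  then have 1: "sign_changes r \<le> max_sign_changes xs" by (rule sign_changes_le_max)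
  let ?ch = "\<lambda>s. {l. Suc l < length s \<and> s ! l * s ! Suc l < (0::real)}"
  let ?N = "{..<n - 1}"
  let ?f = "\<lambda>i. n - 2 - i"
  \<comment> \<open>The pair of neighbours starting at \<open>i\<close> in \<open>s\<close> becomes the pair starting at \<open>n - 2 - i\<close> in \<open>r\<close>.\<close>
  have "?f ` (?N - ?ch s) \<subseteq> ?ch r"
  proof
    fix l assume "l \<in> ?f ` (?N - ?ch s)"
    then obtain i where i: "i < n - 1" "\<not> s ! i * s ! Suc i < 0" "l = n - 2 - i"
      using lens by auto
    have l: "Suc l < n" "l < n" "n - 1 - l = Suc i" "n - 1 - Suc l = i" using i by auto
    have "r ! l * r ! Suc l = - (s ! i * s ! Suc i)"
      unfolding r[OF l(1)] r[OF l(2)] l(3,4) using sgnd(2) pm[of i] by auto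
    moreover have "s ! i * s ! Suc i > 0"
      using i(2) sgn_s[of i] sgn_s[of "Suc i"] l(3,4) l(1) by fastforce
    ultimately have "r ! l * r ! Suc l < 0" by simp
    then show "l \<in> ?ch r" using l(1) by (auto simp: lenr)
  qed
  moreover have fin: "finite (?ch r)" for r
    by (rule finite_subset[of _ "{..<length r}"]) auto
  ultimately have "card (?f ` (?N - ?ch s)) \<le> card (?ch r)" by (intro card_mono)
  moreover have "inj_on ?f (?N - ?ch s)" by (auto simp: inj_on_def)
  then have "card (?f ` (?N - ?ch s)) = card (?N - ?ch s)" by (rule card_image)
  moreover have "card (?N - ?ch s) \<ge> card ?N - card (?ch s)"
    by (rule diff_card_le_card_Diff) (rule fin)
  ultimately have "n - 1 \<le> sign_changes r + sign_changes s" unfolding sign_changes_def by simp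
  then show ?thesis using 1 s(2) by linarith
qed simp

section \<open>Unitriangular matrices that do not increase the number of sign changes\<close>

lemma obtain_inverse_mat:
  fixes P :: "real mat"
  assumes P: "P \<in> carrier_mat n n" and d: "det P \<noteq> 0"
  obtains Q where "Q \<in> carrier_mat n n" "P * Q = 1\<^sub>m n" "Q * P = 1\<^sub>m n"
  using det_non_zero_imp_unit[OF P d, of undefined] by (auto simp: Units_def ring_mat_def)

text \<open>
  Below the diagonal, the rows of \<open>B\<close> vanish by induction from the last row upwards: if all lower rows do,
  the equation for the entry \<open>(i, j)\<close> of the product only retains the diagonal entry of \<open>A\<close> times
  the entry of \<open>B\<close>.
\<close>

lemma upper_triangular_right_inverse:
  fixes A B :: "real mat"
  assumes A: "A \<in> carrier_mat n n" and B: "B \<in> carrier_mat n n"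
    and AB: "A * B = 1\<^sub>m n" and upA: "upper_triangular A"
  shows "upper_triangular B"
proof -
  have "det A \<noteq> 0" using det_mult[OF A B] AB by auto
  then have diag: "A $$ (i, i) \<noteq> 0" if "i < n" for i
    using upper_triangular_imp_det_eq_0_iff[OF A upA] A that by (force simp: diag_mat_def)
  have "\<forall>j<i. B $$ (i, j) = 0" if "i < n" for i
    using that
  proof (induction "n - i" arbitrary: i rule: less_induct)
    case less
    show ?case
    proof (intro allI impI)
      fix j assume j: "j < i"
      have "(A * B) $$ (i, j) = (\<Sum>l\<in>{0..<n}. A $$ (i, l) * B $$ (l, j))"
        using A B less.prems j by (simp add: scalar_prod_def)
      also have "\<dots> = (\<Sum>l\<in>{i}. A $$ (i, l) * B $$ (l, j))"
      proof (rule sum.mono_neutral_right)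
        show "\<forall>l\<in>{0..<n} - {i}. A $$ (i, l) * B $$ (l, j) = 0"
        proof
          fix l assume l: "l \<in> {0..<n} - {i}"
          show "A $$ (i, l) * B $$ (l, j) = 0"
          proof (cases "l < i")
            case True
            then show ?thesis using upper_triangularD[OF upA True] A less.prems by simp
          next
            case False
            then show ?thesis using less.hyps[of l] l j by auto
          qed
        qed
      qed (use less.prems in auto)
      finally have "A $$ (i, i) * B $$ (i, j) = 0" using AB less.prems j by simp
      then show "B $$ (i, j) = 0" using diag[OF less.prems] by simp
    qed
  qed
  then show ?thesis using B by (intro upper_triangularI) auto
qed

lemma upper_triangular_mult_index:
  fixes A B :: "real mat"
  assumes A: "A \<in> carrier_mat n n" "upper_triangular A"
    and B: "B \<in> carrier_mat n n" "upper_triangular B"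
    and ij: "i < n" "j \<le> i"
  shows "(A * B) $$ (i, j) = A $$ (i, i) * B $$ (i, j)"
proof -
  have zero: "A $$ (i, l) * B $$ (l, j) = 0" if "l \<noteq> i" "l < n" for l
    using upper_triangularD[OF A(2), of l i] upper_triangularD[OF B(2), of j l] A(1) B(1) that ij
    by (cases "l < i") auto
  have "(A * B) $$ (i, j) = (\<Sum>l\<in>{0..<n}. A $$ (i, l) * B $$ (l, j))"
    using A B ij by (simp add: scalar_prod_def)
  also have "\<dots> = (\<Sum>l\<in>{i}. A $$ (i, l) * B $$ (l, j))"
    using zero ij by (intro sum.mono_neutral_right) auto
  finally show ?thesis by simp
qed

lemma unitriangular_mult:
  fixes A B :: "real mat"
  assumes A: "A \<in> carrier_mat n n" "upper_triangular A" "\<forall>i<n. A $$ (i, i) = 1"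
    and B: "B \<in> carrier_mat n n" "upper_triangular B" "\<forall>i<n. B $$ (i, i) = 1"
  shows "upper_triangular (A * B)" "\<forall>i<n. (A * B) $$ (i, i) = 1"
proof -
  note index = upper_triangular_mult_index[OF A(1,2) B(1,2)]
  show "upper_triangular (A * B)"
    using index upper_triangularD[OF B(2)] A(1) B(1) by (intro upper_triangularI) auto
  show "\<forall>i<n. (A * B) $$ (i, i) = 1" using index A(3) B(3) by simp
qed

text \<open>
  Unitriangularity is part of the notion because it preserves the zeros above
  the antidiagonal and the entries on it, and passes to inverses.
\<close>

definition sign_diminishing :: "nat \<Rightarrow> real mat \<Rightarrow> bool" where
  "sign_diminishing n U \<longleftrightarrow> U \<in> carrier_mat n n \<and> upper_triangular U \<and> (\<forall>i<n. U $$ (i, i) = 1) \<and>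
     (\<forall>a\<in>carrier_vec n.
        max_sign_changes (list_of_vec (U *\<^sub>v a)) \<le> max_sign_changes (list_of_vec a))"

lemma sign_diminishing_one: "sign_diminishing n (1\<^sub>m n)"
  by (simp add: sign_diminishing_def)

lemma sign_diminishing_mult:
  assumes A: "sign_diminishing n A" and B: "sign_diminishing n B"
  shows "sign_diminishing n (A * B)"
proof -
  have c: "A \<in> carrier_mat n n" "B \<in> carrier_mat n n"
    using A B by (auto simp: sign_diminishing_def)
  have "max_sign_changes (list_of_vec (A * B *\<^sub>v a)) \<le> max_sign_changes (list_of_vec a)"
    if a: "a \<in> carrier_vec n" for a
  proof -
    have "A * B *\<^sub>v a = A *\<^sub>v (B *\<^sub>v a)" using c a by (rule assoc_mult_mat_vec)
    moreover have "B *\<^sub>v a \<in> carrier_vec n" using c(2) a by simp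
    ultimately show ?thesis using A B a unfolding sign_diminishing_def by (metis order_trans)
  qed
  then show ?thesis
    using A B c unitriangular_mult[of A n B] unfolding sign_diminishing_def by auto
qed

lemma sign_diminishing_inverse:
  assumes U: "sign_diminishing n U"
  obtains V where "V \<in> carrier_mat n n" "U * V = 1\<^sub>m n" "V * U = 1\<^sub>m n"
    "upper_triangular V" "\<And>i. i < n \<Longrightarrow> V $$ (i, i) = 1"
proof -
  have Uc: "U \<in> carrier_mat n n" "upper_triangular U" "\<And>i. i < n \<Longrightarrow> U $$ (i, i) = 1"
    using U by (auto simp: sign_diminishing_def)
  have "0 \<notin> set (diag_mat U)" using Uc by (auto simp: diag_mat_def)
  then have "det U \<noteq> 0" using upper_triangular_imp_det_eq_0_iff[OF Uc(1,2)] by simp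
  then obtain V where V: "V \<in> carrier_mat n n" "U * V = 1\<^sub>m n" "V * U = 1\<^sub>m n"
    by (rule obtain_inverse_mat[OF Uc(1)])
  have up: "upper_triangular V" by (rule upper_triangular_right_inverse[OF Uc(1) V(1,2) Uc(2)])
  have "V $$ (i, i) = 1" if "i < n" for i
    using upper_triangular_mult_index[OF Uc(1,2) V(1) up that, of i] Uc(3) that V(2) by simp
  then show ?thesis using that V up by blast
qed

text \<open>
  Multiplication from the left adds \<open>t i\<close> times row \<open>i + 1\<close> to row \<open>i\<close>, using the original rows
  throughout.
\<close>

definition bidiagonal :: "nat \<Rightarrow> (nat \<Rightarrow> real) \<Rightarrow> real mat" where
  "bidiagonal n t = mat n n (\<lambda>(i, j). if j = i then 1 else if j = Suc i then t i else 0)"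

lemma bidiagonal_carrier [simp]: "bidiagonal n t \<in> carrier_mat n n"
  by (simp add: bidiagonal_def)

lemma upper_triangular_bidiagonal: "upper_triangular (bidiagonal n t)"
  by (auto simp: bidiagonal_def)

lemma det_bidiagonal: "det (bidiagonal n t) = 1"
proof -
  have "diag_mat (bidiagonal n t) = map (\<lambda>_. 1) [0..<n]"
    by (auto simp: bidiagonal_def diag_mat_def)
  then show ?thesis
    using det_upper_triangular[OF upper_triangular_bidiagonal bidiagonal_carrier, of n t]
    by (simp add: map_replicate_const prod_list_replicate)
qed

lemma sum_bidiagonal:
  fixes f :: "nat \<Rightarrow> real"
  assumes "i < n"
  shows "(\<Sum>l\<in>{0..<n}. (if l = i then 1 else if l = Suc i then t i else 0) * f l)
    = f i + (if Suc i < n then t i * f (Suc i) else 0)"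
proof -
  have "(\<Sum>l\<in>{0..<n}. (if l = i then 1 else if l = Suc i then t i else 0) * f l)
    = (\<Sum>l\<in>{0..<n}. (if l = i then f i else 0) + (if l = Suc i then t i * f (Suc i) else 0))"
    by (rule sum.cong) auto
  then show ?thesis using assms by (simp add: sum.distrib)
qed

lemma bidiagonal_mult_index:
  assumes "X \<in> carrier_mat n m" "i < n" "j < m"
  shows "(bidiagonal n t * X) $$ (i, j)
    = X $$ (i, j) + (if Suc i < n then t i * X $$ (Suc i, j) else 0)"
proof -
  have "(bidiagonal n t * X) $$ (i, j)
    = (\<Sum>l\<in>{0..<n}. (if l = i then 1 else if l = Suc i then t i else 0) * X $$ (l, j))"
    using assms unfolding bidiagonal_def by (simp add: scalar_prod_def)
  then show ?thesis using sum_bidiagonal[OF assms(2), of t "\<lambda>l. X $$ (l, j)"] by simp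
qed

lemma bidiagonal_mult_vec_index:
  assumes "a \<in> carrier_vec n" "i < n"
  shows "(bidiagonal n t *\<^sub>v a) $ i = a $ i + (if Suc i < n then t i * a $ Suc i else 0)"
proof -
  have "(bidiagonal n t *\<^sub>v a) $ i
    = (\<Sum>l\<in>{0..<n}. (if l = i then 1 else if l = Suc i then t i else 0) * a $ l)"
    using assms unfolding bidiagonal_def by (simp add: scalar_prod_def)
  then show ?thesis using sum_bidiagonal[OF assms(2), of t "\<lambda>l. a $ l"] by simp
qed

lemma sign_diminishing_bidiagonal:
  assumes t: "\<And>i. Suc i < n \<Longrightarrow> t i \<ge> 0"
  shows "sign_diminishing n (bidiagonal n t)"
proof -
  have "max_sign_changes (list_of_vec (bidiagonal n t *\<^sub>v a)) \<le> max_sign_changes (list_of_vec a)"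
    if a: "a \<in> carrier_vec n" for a
  proof (cases "n = 0")
    case True
    then have "bidiagonal n t *\<^sub>v a = a" using a by (intro eq_vecI) (auto simp: bidiagonal_def)
    then show ?thesis by simp
  next
    case False
    have dim: "dim_vec (bidiagonal n t *\<^sub>v a) = n" by (simp add: bidiagonal_def)
    have "list_of_vec (bidiagonal n t *\<^sub>v a)
      = map (\<lambda>i. if i < n - 1 then a $ i + t i * a $ Suc i else a $ i) [0..<n]"
      using bidiagonal_mult_vec_index[OF a] dim
      by (intro nth_equalityI) (auto simp: list_of_vec_index simp del: index_mult_mat_vec)
    moreover have "list_of_vec a = map (\<lambda>i. a $ i) [0..<n]"
      using a by (intro nth_equalityI) (auto simp: list_of_vec_index simp del: index_mult_mat_vec)
    ultimately show ?thesis
      using max_sign_changes_bidiagonal[of "n - 1" n t "\<lambda>i. a $ i"] t False by simp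
  qed
  moreover have "bidiagonal n t $$ (i, i) = 1" if "i < n" for i
    using that by (simp add: bidiagonal_def)
  ultimately show ?thesis
    unfolding sign_diminishing_def using upper_triangular_bidiagonal bidiagonal_carrier by blast
qed

section \<open>Neville elimination\<close>

definition contiguous_minor :: "real mat \<Rightarrow> nat \<Rightarrow> nat \<Rightarrow> nat \<Rightarrow> real" where
  "contiguous_minor X p s j = det (mat j j (\<lambda>(r, c). X $$ (p + r, s + c)))"

lemma contiguous_minor_1: "contiguous_minor X p s 1 = X $$ (p, s)"
  by (simp add: contiguous_minor_def det_single)

text \<open>
  The identity behind Neville elimination. Within the rows of the minor on the left, the row operations
  leave only the last entry of the first column, and expanding along this column gives the minor of the
  transformed matrix. The last row must not be changed, so the operations are restricted to the block.
\<close>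

lemma contiguous_minor_elimination:
  fixes X :: "real mat"
  assumes X: "X \<in> carrier_mat n n" and p: "p + j < n" and s: "s + j < n"
    and t: "\<And>i. p \<le> i \<Longrightarrow> i < p + j \<Longrightarrow> X $$ (i, s) + t i * X $$ (Suc i, s) = 0"
  shows "contiguous_minor X p s (Suc j)
    = (-1) ^ j * X $$ (p + j, s) * contiguous_minor (bidiagonal n t * X) p (Suc s) j"
proof -
  let ?N = "mat (Suc j) (Suc j) (\<lambda>(r, c). X $$ (p + r, s + c))"
  let ?T = "bidiagonal (Suc j) (\<lambda>r. t (p + r))"
  define N' where "N' = ?T * ?N"
  have N: "?N \<in> carrier_mat (Suc j) (Suc j)" by simp
  have N': "N' \<in> carrier_mat (Suc j) (Suc j)"
    unfolding N'_def using bidiagonal_carrier N by (rule mult_carrier_mat)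
  have ent: "N' $$ (r, c) = X $$ (p + r, s + c) + (if r < j then t (p + r) * X $$ (p + Suc r, s + c) else 0)"
    if "r < Suc j" "c < Suc j" for r c
    unfolding N'_def using bidiagonal_mult_index[OF N that] that by simp
  have col0: "N' $$ (r, 0) = 0" if "r < j" for r using ent[of r 0] t[of "p + r"] that by simp
  have "det N' = (\<Sum>i<Suc j. N' $$ (i, 0) * cofactor N' i 0)"
    using laplace_expansion_column[OF N', of 0] by simp
  also have "\<dots> = N' $$ (j, 0) * cofactor N' j 0" using col0 by simp
  also have "N' $$ (j, 0) = X $$ (p + j, s)" using ent[of j 0] by simp
  also have "cofactor N' j 0 = (-1) ^ j * det (mat_delete N' j 0)" by (simp add: cofactor_def)
  also have "mat_delete N' j 0 = mat j j (\<lambda>(r, c). (bidiagonal n t * X) $$ (p + r, Suc s + c))"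
  proof (rule eq_matI)
    fix r c assume "r < dim_row (mat j j (\<lambda>(r, c). (bidiagonal n t * X) $$ (p + r, Suc s + c)))"
      and "c < dim_col (mat j j (\<lambda>(r, c). (bidiagonal n t * X) $$ (p + r, Suc s + c)))"
    then have rc: "r < j" "c < j" by auto
    have "mat_delete N' j 0 $$ (r, c) = N' $$ (r, Suc c)"
      using rc N' by (simp add: mat_delete_def)
    also have "\<dots> = (bidiagonal n t * X) $$ (p + r, Suc s + c)"
      using ent[of r "Suc c"] rc bidiagonal_mult_index[OF X, of "p + r" "Suc s + c" t] p s by simp
    finally show "mat_delete N' j 0 $$ (r, c)
      = mat j j (\<lambda>(r, c). (bidiagonal n t * X) $$ (p + r, Suc s + c)) $$ (r, c)" using rc by simp
  qed (use N' in auto)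
  finally have "det N' = X $$ (p + j, s) * ((-1) ^ j * contiguous_minor (bidiagonal n t * X) p (Suc s) j)"
    by (simp add: contiguous_minor_def)
  moreover have "det N' = contiguous_minor X p s (Suc j)"
    unfolding N'_def using det_mult[OF bidiagonal_carrier N] by (simp add: det_bidiagonal contiguous_minor_def)
  ultimately show ?thesis by simp
qed

text \<open>
  The invariant of the elimination after \<open>s\<close> columns. The finished columns vanish above the antidiagonal,
  with pivots of alternating sign on it. What remains to be treated are the first \<open>n - s\<close> rows and the
  columns from \<open>s\<close> on; there the minors on contiguous rows and initial columns have the signs that a
  hyperconvex triple prescribes in dimension \<open>n - s\<close>, where \<open>j (n - s - p - j)\<close> counts the
  transpositions that move the \<open>j\<close> columns past the last \<open>n - s - p - j\<close> basis vectors. Each finished column flips the sign \<open>\<epsilon>\<close>.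
\<close>

definition eliminated_columns :: "nat \<Rightarrow> real \<Rightarrow> nat \<Rightarrow> real mat \<Rightarrow> bool" where
  "eliminated_columns n \<epsilon> s X \<longleftrightarrow> X \<in> carrier_mat n n \<and>
     (\<forall>j<s. \<forall>i. i + j + 1 < n \<longrightarrow> X $$ (i, j) = 0) \<and>
     (\<forall>j<s. \<epsilon> * (-1) ^ j * X $$ (n - 1 - j, j) > 0) \<and>
     (\<forall>p j. p + j \<le> n - s \<longrightarrow>
        (\<epsilon> * (-1) ^ s) ^ j * (-1) ^ (j * (n - s - p - j)) * contiguous_minor X p s j > 0)"

text \<open>
  The minors of size one say that the active part of column \<open>s\<close> alternates in sign, so clearing each entry
  by means of its lower neighbour takes positive multipliers. The minors of the next stage are those of the
  present one of one size more, divided by an entry of column \<open>s\<close>, which settles their signs.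
\<close>

lemma eliminate_column:
  assumes X: "eliminated_columns n \<epsilon> s X" and s: "s < n"
  obtains B where "sign_diminishing n B" "eliminated_columns n \<epsilon> (Suc s) (B * X)"
proof -
  let ?m = "n - s"
  define \<delta> where "\<delta> = \<epsilon> * (-1) ^ s"
  have Xc: "X \<in> carrier_mat n n"
    and zero: "\<And>i j. j < s \<Longrightarrow> i + j + 1 < n \<Longrightarrow> X $$ (i, j) = 0"
    and pivot: "\<And>j. j < s \<Longrightarrow> \<epsilon> * (-1) ^ j * X $$ (n - 1 - j, j) > 0"
    and minor: "\<And>p j. p + j \<le> ?m \<Longrightarrow>
      \<delta> ^ j * (-1) ^ (j * (?m - p - j)) * contiguous_minor X p s j > 0"
    using X unfolding eliminated_columns_def \<delta>_def by auto
  have c: "\<delta> * (-1) ^ (?m - i - 1) * X $$ (i, s) > 0" if "i < ?m" for i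
    using minor[of i 1] that by (simp only: contiguous_minor_1) simp
  define t where "t = (\<lambda>i. if Suc i < ?m then - X $$ (i, s) / X $$ (Suc i, s) else 0)"
  let ?B = "bidiagonal n t"
  have t0: "t i \<ge> 0" "Suc i < ?m \<Longrightarrow> X $$ (i, s) + t i * X $$ (Suc i, s) = 0" for i
  proof -
    have "t i \<ge> 0 \<and> (Suc i < ?m \<longrightarrow> X $$ (i, s) + t i * X $$ (Suc i, s) = 0)"
    proof (cases "Suc i < ?m")
      case True
      define q where "q = ?m - Suc i - 1"
      have "?m - i - 1 = Suc q" using True by (simp add: q_def)
      then have 1: "\<delta> * (-1) ^ q * X $$ (i, s) < 0" using c[of i] True by simp
      have 2: "\<delta> * (-1) ^ q * X $$ (Suc i, s) > 0" using c[of "Suc i"] True by (simp add: q_def)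
      from 1 2 have "X $$ (i, s) / X $$ (Suc i, s) < 0" "X $$ (Suc i, s) \<noteq> 0"
        by (auto simp: mult_less_0_iff zero_less_mult_iff divide_less_0_iff)
      then show ?thesis using True by (simp add: t_def)
    qed (simp add: t_def)
    then show "t i \<ge> 0" "Suc i < ?m \<Longrightarrow> X $$ (i, s) + t i * X $$ (Suc i, s) = 0" by auto
  qed
  have B: "sign_diminishing n ?B" by (rule sign_diminishing_bidiagonal) (rule t0(1))
  have BX: "?B * X \<in> carrier_mat n n" using bidiagonal_carrier Xc by (rule mult_carrier_mat)
  have ent: "(?B * X) $$ (i, j) = X $$ (i, j) + (if Suc i < n then t i * X $$ (Suc i, j) else 0)"
    if "i < n" "j < n" for i j
    using bidiagonal_mult_index[OF Xc that] .
  have "eliminated_columns n \<epsilon> (Suc s) (?B * X)"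
    unfolding eliminated_columns_def
  proof (intro conjI allI impI)
    show "?B * X \<in> carrier_mat n n" by (rule BX)
  next
    fix j i assume j: "j < Suc s" and ij: "i + j + 1 < n"
    show "(?B * X) $$ (i, j) = 0"
    proof (cases "j = s")
      case True
      then show ?thesis using ent[of i j] ij s t0(2)[of i] by simp
    next
      case False
      then have js: "j < s" using j by simp
      \<comment> \<open>The row below may meet the antidiagonal in column \<open>j\<close>, but only outside the active rows.\<close>
      have "t i * X $$ (Suc i, j) = 0"
      proof (cases "Suc i + j + 1 < n")
        case True
        then show ?thesis using zero[OF js True] by simp
      next
        case False
        then have "\<not> Suc i < ?m" using js by simp
        then show ?thesis by (simp add: t_def)
      qed
      then show ?thesis using ent[of i j] zero[OF js ij] ij by simp
    qed
  next
    fix j assume j: "j < Suc s"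
    have "t (n - 1 - j) = 0" using j s by (simp add: t_def)
    then have "(?B * X) $$ (n - 1 - j, j) = X $$ (n - 1 - j, j)"
      using ent[of "n - 1 - j" j] j s by simp
    moreover have "\<epsilon> * (-1) ^ j * X $$ (n - 1 - j, j) > 0"
    proof (cases "j = s")
      case True
      then show ?thesis using c[of "n - 1 - s"] s by (simp add: \<delta>_def)
    next
      case False
      then show ?thesis using pivot[of j] j by simp
    qed
    ultimately show "\<epsilon> * (-1) ^ j * (?B * X) $$ (n - 1 - j, j) > 0" by simp
  next
    fix p j assume pj: "p + j \<le> n - Suc s"
    define q where "q = ?m - p - j - 1"
    define y where "y = contiguous_minor (?B * X) p (Suc s) j"
    let ?c = "X $$ (p + j, s)"
    have q: "n - Suc s - p - j = q" "?m - p - Suc j = q" "?m - (p + j) - 1 = q"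
      using pj s by (auto simp: q_def)
    have step: "contiguous_minor X p s (Suc j) = (-1) ^ j * ?c * y"
      unfolding y_def
    proof (rule contiguous_minor_elimination[OF Xc])
      show "X $$ (i, s) + t i * X $$ (Suc i, s) = 0" if "p \<le> i" "i < p + j" for i
        using that pj by (intro t0(2)) simp
    qed (use pj s in auto)
    have "p + Suc j \<le> ?m" using pj s by simp
    from minor[OF this] have 1: "\<delta> ^ Suc j * (-1) ^ (Suc j * q) * ((-1) ^ j * ?c * y) > 0"
      unfolding q(2) step .
    have 2: "\<delta> * (-1) ^ q * ?c > 0" using c[of "p + j"] pj s q(3) by simp
    \<comment> \<open>The sign prescribed at size \<open>j + 1\<close> is that of the dividing entry times the one prescribed
        at size \<open>j\<close> in the next stage, where \<open>\<delta>\<close> has become \<open>-\<delta>\<close>.\<close>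
    have "\<delta> ^ Suc j * (-1) ^ (Suc j * q) * ((-1) ^ j * ?c * y)
      = (\<delta> * (-1) ^ q * ?c) * ((- \<delta>) ^ j * (-1) ^ (j * q) * y)"
      by (simp add: power_add power_minus[of \<delta> j])
    with 1 2 have "(- \<delta>) ^ j * (-1) ^ (j * q) * y > 0" by (metis zero_less_mult_pos)
    then show "(\<epsilon> * (-1) ^ Suc s) ^ j * (-1) ^ (j * (n - Suc s - p - j)) * contiguous_minor (?B * X) p (Suc s) j > 0"
      unfolding q(1) y_def by (simp add: \<delta>_def)
  qed
  with B show ?thesis by (rule that)
qed

lemma elimination:
  assumes C: "eliminated_columns n \<epsilon> 0 C"
  obtains U where "sign_diminishing n U" "eliminated_columns n \<epsilon> n (U * C)"
proof -
  have Cc: "C \<in> carrier_mat n n" using C by (simp add: eliminated_columns_def)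
  have "\<exists>U. sign_diminishing n U \<and> eliminated_columns n \<epsilon> s (U * C)" if "s \<le> n" for s
    using that
  proof (induction s)
    case 0
    then show ?case using C Cc sign_diminishing_one by (intro exI[of _ "1\<^sub>m n"]) simp
  next
    case (Suc s)
    then obtain U where U: "sign_diminishing n U" "eliminated_columns n \<epsilon> s (U * C)" by auto
    obtain B where B: "sign_diminishing n B" "eliminated_columns n \<epsilon> (Suc s) (B * (U * C))"
      using eliminate_column[OF U(2)] Suc.prems by auto
    have "B * (U * C) = B * U * C"
      using B(1) U(1) Cc by (metis assoc_mult_mat sign_diminishing_def)
    then show ?case using sign_diminishing_mult[OF B(1) U(1)] B(2) by auto
  qed
  then show ?thesis using that by blast
qed

section \<open>Sign changes in two bases in opposite position\<close>

text \<open>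
  Reversing the order of the rows of \<open>Z\<close> makes it upper triangular, and reversing the order of the columns of
  \<open>Z'\<close> makes it lower triangular, and the two remain inverse to each other. The inverse of a lower
  triangular matrix is lower triangular, so the row reversal of \<open>Z\<close> is diagonal.
\<close>

lemma antidiagonal_of_inverse_pair:
  fixes Z Z' :: "real mat"
  assumes Z: "Z \<in> carrier_mat n n" "\<And>i j. i + j + 1 < n \<Longrightarrow> Z $$ (i, j) = 0"
    and Z': "Z' \<in> carrier_mat n n" "\<And>i j. i + j + 1 < n \<Longrightarrow> Z' $$ (i, j) = 0"
    and inv: "Z * Z' = 1\<^sub>m n" and ij: "i < n" "j < n" "i + j + 1 \<noteq> n"
  shows "Z $$ (i, j) = 0"
proof -
  define A where "A = mat n n (\<lambda>(i, j). Z $$ (n - 1 - i, j))"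
  define B where "B = mat n n (\<lambda>(i, j). Z' $$ (i, n - 1 - j))"
  have A: "A \<in> carrier_mat n n" and B: "B \<in> carrier_mat n n" by (auto simp: A_def B_def)
  have "A * B = 1\<^sub>m n"
  proof (rule eq_matI)
    fix i j assume "i < dim_row (1\<^sub>m n :: real mat)" "j < dim_col (1\<^sub>m n :: real mat)"
    then have ij: "i < n" "j < n" by auto
    have "(A * B) $$ (i, j) = (\<Sum>l\<in>{0..<n}. Z $$ (n - 1 - i, l) * Z' $$ (l, n - 1 - j))"
      using ij by (simp add: A_def B_def scalar_prod_def)
    also have "\<dots> = (Z * Z') $$ (n - 1 - i, n - 1 - j)"
      using ij Z(1) Z'(1) by (simp add: scalar_prod_def)
    finally show "(A * B) $$ (i, j) = 1\<^sub>m n $$ (i, j)" unfolding inv using ij by auto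
  qed (use A B in auto)
  then have BA: "B\<^sup>T * A\<^sup>T = 1\<^sub>m n" using transpose_mult[OF A B] by simp
  have upB: "upper_triangular (B\<^sup>T)" using Z'(2) by (auto simp: B_def)
  have "upper_triangular (A\<^sup>T)"
    by (rule upper_triangular_right_inverse[OF _ _ BA upB]) (use A B in auto)
  then have "A $$ (n - 1 - i, j) = 0" if "n - 1 - i < j"
    using upper_triangularD[of "A\<^sup>T" "n - 1 - i" j] that ij A by simp
  then show ?thesis using Z(2)[of i j] ij by (cases "n - 1 - i < j") (auto simp: A_def)
qed

text \<open>
  If \<open>U\<close> and \<open>U'\<close> perform the eliminations of \<open>C\<close> and \<open>C'\<close>, then \<open>Z = U C U'\<^sup>-\<^sup>1\<close> maps \<open>U' (c b)\<close> to
  \<open>U a\<close>. It vanishes above the antidiagonal, as \<open>U C\<close> does and \<open>U'\<close> is upper triangular, and so does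
  its inverse \<open>U' C' U\<^sup>-\<^sup>1\<close>. Hence \<open>Z\<close> is antidiagonal with the alternating pivots as entries. The factor
  \<open>c\<close> allows for two representatives of the same projective point.
\<close>

lemma sign_changes_complementary:
  assumes C: "eliminated_columns n \<epsilon> 0 C" and C': "eliminated_columns n \<epsilon>' 0 C'"
    and inv: "C * C' = 1\<^sub>m n"
    and b: "b \<in> carrier_vec n" and a: "a = C *\<^sub>v (c \<cdot>\<^sub>v b)" and c: "c \<noteq> 0"
  shows "n - 1 \<le> max_sign_changes (list_of_vec a) + max_sign_changes (list_of_vec b)"
proof -
  obtain U where U: "sign_diminishing n U" "eliminated_columns n \<epsilon> n (U * C)"
    by (rule elimination[OF C])
  obtain U' where U': "sign_diminishing n U'" "eliminated_columns n \<epsilon>' n (U' * C')"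
    by (rule elimination[OF C'])
  obtain V where V: "V \<in> carrier_mat n n" "U * V = 1\<^sub>m n" "V * U = 1\<^sub>m n"
    "upper_triangular V" "\<And>i. i < n \<Longrightarrow> V $$ (i, i) = 1"
    using sign_diminishing_inverse[OF U(1)] by blast
  obtain V' where V': "V' \<in> carrier_mat n n" "U' * V' = 1\<^sub>m n" "V' * U' = 1\<^sub>m n"
    "upper_triangular V'" "\<And>i. i < n \<Longrightarrow> V' $$ (i, i) = 1"
    using sign_diminishing_inverse[OF U'(1)] by blast
  have car: "C \<in> carrier_mat n n" "C' \<in> carrier_mat n n" "U \<in> carrier_mat n n" "U' \<in> carrier_mat n n"
    using C C' U(1) U'(1) by (auto simp: eliminated_columns_def sign_diminishing_def)
  \<comment> \<open>Upper unitriangular factors on the right preserve the zeros above the antidiagonal and the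
      antidiagonal itself.\<close>
  have entry: "(X * W) $$ (i, j) = (if i + j + 1 < n then 0 else X $$ (i, j))"
    if X: "X \<in> carrier_mat n n" "\<And>i j. i + j + 1 < n \<Longrightarrow> X $$ (i, j) = 0"
      and W: "W \<in> carrier_mat n n" "upper_triangular W" "\<And>i. i < n \<Longrightarrow> W $$ (i, i) = 1"
      and ij: "i < n" "j < n" "i + j + 1 \<le> n" for X W :: "real mat" and i j
  proof -
    have "(X * W) $$ (i, j) = (\<Sum>l\<in>{0..<n}. X $$ (i, l) * W $$ (l, j))"
      using X W ij by (simp add: scalar_prod_def)
    also have "\<dots> = (\<Sum>l\<in>{j}. X $$ (i, l) * W $$ (l, j))"
    proof (rule sum.mono_neutral_right)
      show "\<forall>l\<in>{0..<n} - {j}. X $$ (i, l) * W $$ (l, j) = 0"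
      proof
        fix l assume l: "l \<in> {0..<n} - {j}"
        then show "X $$ (i, l) * W $$ (l, j) = 0"
          using X(2)[of i l] upper_triangularD[OF W(2), of j l] W(1) ij by (cases "j < l") auto
      qed
    qed (use ij in auto)
    finally show ?thesis using W(3) X(2) ij by simp
  qed
  define Z where "Z = U * C * V'"
  define Z' where "Z' = U' * C' * V"
  have Zc: "Z \<in> carrier_mat n n" "Z' \<in> carrier_mat n n"
    using car V(1) V'(1) by (auto simp: Z_def Z'_def)
  have zero: "Z $$ (i, j) = 0" "Z' $$ (i, j) = 0" if "i + j + 1 < n" for i j
    using entry[of "U * C" V' i j] entry[of "U' * C'" V i j] that U(2) U'(2) V V'
    by (auto simp: Z_def Z'_def eliminated_columns_def)
  have pivot: "\<epsilon> * (-1) ^ j * Z $$ (n - 1 - j, j) > 0" if "j < n" for j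
    using entry[of "U * C" V' "n - 1 - j" j] that U(2) V'
    by (auto simp: Z_def eliminated_columns_def)
  have "Z * Z' = U * (C * (V' * U') * C') * V"
    using car V(1) V'(1) unfolding Z_def Z'_def by (simp add: assoc_mult_mat[of _ n n _ n _ n])
  then have ZZ': "Z * Z' = 1\<^sub>m n" using V'(3) car inv V by (simp add: right_mult_one_mat[of _ n n])
  have anti: "Z $$ (i, j) = 0" if "i < n" "j < n" "i + j + 1 \<noteq> n" for i j
    using antidiagonal_of_inverse_pair[OF Zc(1) zero(1) Zc(2) zero(2) ZZ' that] by simp
  define a' where "a' = U *\<^sub>v a"
  define b' where "b' = U' *\<^sub>v b"
  have b'c: "b' \<in> carrier_vec n" using b car by (simp add: b'_def)
  have "c \<cdot>\<^sub>v b' = U' *\<^sub>v (c \<cdot>\<^sub>v b)"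
    unfolding b'_def by (rule mult_mat_vec[OF car(4) b, symmetric])
  then have "Z *\<^sub>v (c \<cdot>\<^sub>v b') = U * C *\<^sub>v (V' *\<^sub>v (U' *\<^sub>v (c \<cdot>\<^sub>v b)))"
    unfolding Z_def using car V'(1) b by (simp only:) (intro assoc_mult_mat_vec[of _ n n _ n], auto)
  also have "V' *\<^sub>v (U' *\<^sub>v (c \<cdot>\<^sub>v b)) = (V' * U') *\<^sub>v (c \<cdot>\<^sub>v b)"
    using car V'(1) b by (intro assoc_mult_mat_vec[symmetric, of _ n n _ n]) auto
  also have "\<dots> = c \<cdot>\<^sub>v b" using V'(3) b by simp
  also have "U * C *\<^sub>v (c \<cdot>\<^sub>v b) = a'"
    unfolding a'_def a using car b by (intro assoc_mult_mat_vec[of _ n n _ n]) auto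
  finally have a'Z: "a' = Z *\<^sub>v (c \<cdot>\<^sub>v b')" by simp
  have rev: "a' $ (n - 1 - i) = (c * Z $$ (n - 1 - i, i)) * b' $ i" if i: "i < n" for i
  proof -
    have "a' $ (n - 1 - i) = (\<Sum>l\<in>{0..<n}. Z $$ (n - 1 - i, l) * (c * b' $ l))"
      unfolding a'Z using i Zc b'c by (simp add: scalar_prod_def)
    also have "\<dots> = (\<Sum>l\<in>{i}. Z $$ (n - 1 - i, l) * (c * b' $ l))"
      using i anti by (intro sum.mono_neutral_right) auto
    finally show ?thesis by simp
  qed
  have "n - 1 \<le> max_sign_changes (list_of_vec a') + max_sign_changes (list_of_vec b')"
  proof (rule max_sign_changes_reversed)
    show "length (list_of_vec a') = n" "length (list_of_vec b') = n"
      using car b by (auto simp: a'_def b'_def)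
    show "list_of_vec a' ! (n - 1 - i) = (c * Z $$ (n - 1 - i, i)) * list_of_vec b' ! i" if "i < n" for i
      using rev[OF that] that car b by (simp add: list_of_vec_index a'_def b'_def)
    show "c * \<epsilon> * (-1) ^ i * (c * Z $$ (n - 1 - i, i)) > 0" if "i < n" for i
    proof -
      have "c * c > 0" using c by (auto simp: zero_less_mult_iff)
      from mult_pos_pos[OF this pivot[OF that]]
      have "c * c * (\<epsilon> * (-1) ^ i * Z $$ (n - 1 - i, i)) > 0" .
      then show ?thesis by (simp add: ac_simps)
    qed
  qed
  moreover have "max_sign_changes (list_of_vec a') \<le> max_sign_changes (list_of_vec a)"
    using U(1) a b car unfolding a'_def sign_diminishing_def by simp
  moreover have "max_sign_changes (list_of_vec b') \<le> max_sign_changes (list_of_vec b)"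
    using U'(1) b unfolding b'_def sign_diminishing_def by simp
  ultimately show ?thesis by linarith
qed

section \<open>Determinants and changes of bases\<close>

lemma length_base_change: "base_change n bs A cs \<Longrightarrow> length cs = length bs"
  unfolding base_change_def by (metis carrier_matD(2) index_mult_mat(3) mat_of_cols_carrier(3))

lemma base_change_refl: "set bs \<subseteq> carrier_vec n \<Longrightarrow> base_change n bs (1\<^sub>m (length bs)) bs"
  by (simp add: base_change_def right_mult_one_mat[OF mat_of_cols_carrier(1)])

lemma base_change_trans:
  assumes "base_change n bs A cs" "base_change n cs B ds"
  shows "base_change n bs (A * B) ds"
proof -
  have "length cs = length bs" using assms(1) by (rule length_base_change)
  then have "A \<in> carrier_mat (length bs) (length bs)" "B \<in> carrier_mat (length bs) (length bs)"
    "mat_of_cols n ds = (mat_of_cols n bs * A) * B"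
    using assms by (auto simp: base_change_def)
  moreover from this have "mat_of_cols n ds = mat_of_cols n bs * (A * B)"
    using assoc_mult_mat[OF mat_of_cols_carrier(1)] by simp
  ultimately show ?thesis using assms(2) by (auto simp: base_change_def)
qed

lemma det_base_change_trans:
  assumes "base_change n bs A cs" "base_change n cs B ds"
  shows "det (A * B) = det A * det B"
  using assms length_base_change[OF assms(1)] by (intro det_mult) (auto simp: base_change_def)

lemma base_change_sym:
  assumes bc: "base_change n bs A cs" and bs: "set bs \<subseteq> carrier_vec n" and d: "det A \<noteq> 0"
  obtains B where "base_change n cs B bs" "det A * det B = 1"
proof -
  let ?m = "length bs"
  have A: "A \<in> carrier_mat ?m ?m" and eq: "mat_of_cols n cs = mat_of_cols n bs * A"
    using bc by (auto simp: base_change_def)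
  obtain B where B: "B \<in> carrier_mat ?m ?m" "A * B = 1\<^sub>m ?m"
    using obtain_inverse_mat[OF A d] by blast
  have "mat_of_cols n cs * B = mat_of_cols n bs * (A * B)"
    unfolding eq by (rule assoc_mult_mat[OF mat_of_cols_carrier(1) A B(1)])
  then have "mat_of_cols n bs = mat_of_cols n cs * B"
    unfolding B(2) by (simp add: right_mult_one_mat[OF mat_of_cols_carrier(1)])
  then have "base_change n cs B bs"
    using bs B(1) length_base_change[OF bc] by (simp add: base_change_def)
  moreover have "det A * det B = 1" using det_mult[OF A B(1)] B(2) by simp
  ultimately show ?thesis by (rule that)
qed

text \<open>
  Replacing one block of columns amounts to multiplying by a block diagonal matrix with identity blocks
  before and after the transition matrix.
\<close>

lemma det_mat_of_cols_base_change:
  assumes bc: "base_change n ys A xs" and len: "length us + length ys + length ws = n"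
  shows "det (mat_of_cols n (us @ xs @ ws)) = det A * det (mat_of_cols n (us @ ys @ ws))"
proof -
  let ?a = "length us" and ?b = "length ys" and ?c = "length ws"
  have A: "A \<in> carrier_mat ?b ?b" and eq: "mat_of_cols n xs = mat_of_cols n ys * A"
    using bc by (auto simp: base_change_def)
  have lx: "length xs = ?b" using bc by (rule length_base_change)
  define D2 where "D2 = four_block_mat A (0\<^sub>m ?b ?c) (0\<^sub>m ?c ?b) (1\<^sub>m ?c)"
  define D where "D = four_block_mat (1\<^sub>m ?a) (0\<^sub>m ?a (?b + ?c)) (0\<^sub>m (?b + ?c) ?a) D2"
  have D2: "D2 \<in> carrier_mat (?b + ?c) (?b + ?c)" using A by (auto simp: D2_def)
  have "D \<in> carrier_mat (?a + (?b + ?c)) (?a + (?b + ?c))" using D2 by (simp add: D_def)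
  then have D: "D \<in> carrier_mat n n" using len by (simp add: add.assoc)
  have "det D2 = det A"
    unfolding D2_def by (subst det_four_block_mat_lower_left_zero[OF A]) auto
  then have det: "det D = det A"
    unfolding D_def by (subst det_four_block_mat_lower_left_zero[OF one_carrier_mat _ refl D2]) auto
  let ?Y = "mat_of_cols n (us @ ys @ ws)"
  have Y: "?Y \<in> carrier_mat n n" using mat_of_cols_carrier(1)[of n "us @ ys @ ws"] len by (simp add: add.assoc)
  have entD: "D $$ (l, j) = (if ?a \<le> j \<and> j < ?a + ?b
      then (if ?a \<le> l \<and> l < ?a + ?b then A $$ (l - ?a, j - ?a) else 0) else if l = j then 1 else 0)"
    if "l < n" "j < n" for l j
    using that A len unfolding D_def D2_def by auto
  have "mat_of_cols n (us @ xs @ ws) = ?Y * D"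
  proof (rule eq_matI)
    fix i j assume "i < dim_row (?Y * D)" "j < dim_col (?Y * D)"
    then have ij: "i < n" "j < n" using Y D by auto
    have "(?Y * D) $$ (i, j) = (\<Sum>l\<in>{0..<n}. (us @ ys @ ws) ! l $ i * D $$ (l, j))"
      using ij Y D len by (simp add: scalar_prod_def mat_of_cols_index)
    also have "\<dots> = (us @ xs @ ws) ! j $ i"
    proof (cases "?a \<le> j \<and> j < ?a + ?b")
      case False
      then have "(\<Sum>l\<in>{0..<n}. (us @ ys @ ws) ! l $ i * D $$ (l, j))
        = (\<Sum>l\<in>{0..<n}. if l = j then (us @ ys @ ws) ! j $ i else 0)"
        using entD ij by (intro sum.cong) auto
      also have "\<dots> = (us @ ys @ ws) ! j $ i" using ij by simp
      also have "\<dots> = (us @ xs @ ws) ! j $ i" using False lx by (auto simp: nth_append)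
      finally show ?thesis .
    next
      case True
      then have jb: "j - ?a < ?b" by auto
      have "(\<Sum>l\<in>{0..<n}. (us @ ys @ ws) ! l $ i * D $$ (l, j))
        = (\<Sum>l\<in>{?a..<?a + ?b}. (us @ ys @ ws) ! l $ i * D $$ (l, j))"
        using entD ij True len by (intro sum.mono_neutral_right) auto
      also have "\<dots> = (\<Sum>l\<in>{0..<?b}. (us @ ys @ ws) ! (l + ?a) $ i * D $$ (l + ?a, j))"
        using sum.shift_bounds_nat_ivl[of _ 0 ?a ?b] by (simp add: add.commute)
      also have "\<dots> = (\<Sum>l\<in>{0..<?b}. ys ! l $ i * A $$ (l, j - ?a))"
        using entD ij True len by (intro sum.cong) (auto simp: nth_append)
      also have "\<dots> = (mat_of_cols n ys * A) $$ (i, j - ?a)"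
        using ij A jb by (simp add: scalar_prod_def mat_of_cols_index)
      also have "\<dots> = (us @ xs @ ws) ! j $ i"
        unfolding eq[symmetric] using True jb lx ij by (simp add: mat_of_cols_index nth_append)
      finally show ?thesis .
    qed
    finally show "mat_of_cols n (us @ xs @ ws) $$ (i, j) = (?Y * D) $$ (i, j)"
      using ij lx len by (simp add: mat_of_cols_index)
  qed (use D lx len in auto)
  then show ?thesis using det_mult[OF Y D] det by simp
qed

lemma det_mat_of_cols_swap:
  assumes len: "length us + length vs + length ws = n"
  shows "det (mat_of_cols n (us @ vs @ ws))
    = (-1) ^ (length vs * length ws) * det (mat_of_cols n (us @ ws @ vs) :: real mat)"
proof -
  let ?X = "mat_of_cols n (us @ vs @ ws) :: real mat"
  have X: "?X \<in> carrier_mat n n" using mat_of_cols_carrier(1)[of n "us @ vs @ ws"] len by (simp add: add.assoc)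
  have "mat n n (\<lambda>(i, j). ?X $$ (i, if j < length us then j else
      if j < length us + length ws then j + length vs else j - length ws))
    = mat_of_cols n (us @ ws @ vs)"
    using len by (intro eq_matI) (auto simp: mat_of_cols_index nth_append ac_simps)
  then show ?thesis using det_swap_final_cols[OF X len[symmetric]] by simp
qed

lemma mat_of_cols_unit_vecs: "mat_of_cols n (unit_vecs n) = (1\<^sub>m n :: real mat)"
  by (intro eq_matI) (auto simp: mat_of_cols_index unit_vecs_def)

lemma standard_orientationD:
  assumes "E \<in> standard_orientation n"
  shows "length E = n" "set E \<subseteq> carrier_vec n" "mat_of_cols n E \<in> carrier_mat n n"
    "det (mat_of_cols n E) > 0"
proof -
  obtain A where A: "base_change n (unit_vecs n) A E" "det A > 0"
    using assms by (auto simp: standard_orientation_def orientation_def)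
  have l: "length (unit_vecs n :: real vec list) = n" by (simp add: unit_vecs_def)
  show len: "length E = n" using length_base_change[OF A(1)] l by simp
  show "set E \<subseteq> carrier_vec n" using A(1) by (simp add: base_change_def)
  show "mat_of_cols n E \<in> carrier_mat n n" using mat_of_cols_carrier(1)[of n E] len by simp
  have "A \<in> carrier_mat n n" "mat_of_cols n E = 1\<^sub>m n * A"
    using A(1) l by (auto simp: base_change_def mat_of_cols_unit_vecs)
  then show "det (mat_of_cols n E) > 0" using A(2) by simp
qed

lemma coordinates_eq:
  assumes E: "length E = n" "det (mat_of_cols n E) \<noteq> 0"
    and a: "a \<in> carrier_vec n" "mat_of_cols n E *\<^sub>v a = v"
  shows "coordinates n E v = list_of_vec a"
proof -
  have P: "mat_of_cols n E \<in> carrier_mat n n" using mat_of_cols_carrier(1)[of n E] E(1) by simp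
  obtain Q where Q: "Q \<in> carrier_mat n n" "Q * mat_of_cols n E = 1\<^sub>m n"
    using obtain_inverse_mat[OF P E(2)] by blast
  have eq: "x = Q *\<^sub>v v" if "x \<in> carrier_vec n" "mat_of_cols n E *\<^sub>v x = v" for x
    using assoc_mult_mat_vec[OF Q(1) P that(1)] that Q(2) by simp
  have "(THE x. x \<in> carrier_vec n \<and> mat_of_cols n E *\<^sub>v x = v) = a"
    using a eq by (intro the_equality) (blast, metis)
  then show ?thesis by (simp add: coordinates_def)
qed

section \<open>Hyperconvex triples as sign conditions on determinants\<close>

text \<open>
  A lift of \<open>F\<close> is given by a positively oriented basis \<open>B i\<close> of each of its spaces. The bases of
  different spaces need not extend each other: the final flag of a list consists of its suffixes.
\<close>

definition basis_lift :: "nat \<Rightarrow> (nat \<Rightarrow> real vec list) \<Rightarrow> oriented_flag set \<Rightarrow> bool" where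
  "basis_lift n B F \<longleftrightarrow> (\<forall>i<n. set (B i) \<subseteq> carrier_vec n \<and> length (B i) = i) \<and>
     (\<exists>H\<in>F. \<forall>i<n. H i = orientation n (B i))"

text \<open>
  Two lifts of the same class differ by a simultaneous reversal in odd dimensions, that is, by a factor
  \<open>s\<^sup>i\<close> in dimension \<open>i\<close>. The relation on lifts is not symmetric by definition, which is why the reversal
  is considered in both directions.
\<close>

lemma lift_sign:
  assumes F: "F \<in> Flag\<^sup>+ n" "G \<in> F" and B: "basis_lift n B F"
  obtains s :: real where "s = 1 \<or> s = -1"
    and "\<And>i bs. i < n \<Longrightarrow> bs \<in> G i \<Longrightarrow> \<exists>A. base_change n (B i) A bs \<and> s ^ i * det A > 0"
proof -
  obtain H where HF: "H \<in> F" and H: "\<And>i. i < n \<Longrightarrow> H i = orientation n (B i)"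
      "\<And>i. i < n \<Longrightarrow> set (B i) \<subseteq> carrier_vec n"
    using B by (auto simp: basis_lift_def)
  have G: "G \<in> oriented_flags n" and GH: "G = H \<or> G = reverse_odd n H \<or> H = reverse_odd n G"
    using F HF by (auto simp: flag_plus_def quotient_def flag_rel_def)
  from GH show ?thesis
  proof (elim disjE)
    assume "G = H"
    then show ?thesis using H(1) by (intro that[of 1]) (auto simp: orientation_def)
  next
    assume eq: "G = reverse_odd n H"
    show ?thesis
    proof (rule that[of "-1"])
      fix i bs assume i: "i < n" "bs \<in> G i"
      show "\<exists>A. base_change n (B i) A bs \<and> (-1) ^ i * det A > 0"
      proof (cases "odd i")
        case True
        then obtain cs A A' where "base_change n (B i) A cs" "det A > 0" "base_change n cs A' bs" "det A' < 0"
          using i eq H(1) by (auto simp: reverse_odd_def reverse_orientation_def orientation_def)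
        then show ?thesis using True base_change_trans[of n "B i" A cs A' bs]
            det_base_change_trans[of n "B i" A cs A' bs]
          by (intro exI[of _ "A * A'"]) (auto simp: mult_less_0_iff)
      next
        case False
        then show ?thesis using i eq H(1) by (auto simp: reverse_odd_def orientation_def)
      qed
    qed simp
  next
    assume eq: "H = reverse_odd n G"
    show ?thesis
    proof (rule that[of "-1"])
      fix i bs assume i: "i < n" "bs \<in> G i"
      show "\<exists>A. base_change n (B i) A bs \<and> (-1) ^ i * det A > 0"
      proof (cases "odd i")
        case True
        have "B i \<in> H i" using H i(1) base_change_refl[of "B i" n] unfolding orientation_def by force
        then obtain cs A where cs: "cs \<in> G i" "base_change n cs A (B i)" "det A < 0"
          using True eq by (auto simp: reverse_odd_def reverse_orientation_def)
        obtain gs where gs: "G i = orientation n gs" "set gs \<subseteq> carrier_vec n"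
          using G i(1) by (auto simp: oriented_flags_def oriented_subspaces_def independent_list_def)
        obtain A1 where A1: "base_change n gs A1 cs" "det A1 > 0"
          using cs(1) gs(1) by (auto simp: orientation_def)
        obtain A2 where A2: "base_change n gs A2 bs" "det A2 > 0"
          using i(2) gs(1) by (auto simp: orientation_def)
        have AA: "base_change n gs (A1 * A) (B i)" "det (A1 * A) < 0"
          using base_change_trans[OF A1(1) cs(2)] det_base_change_trans[OF A1(1) cs(2)] A1(2) cs(3)
          by (auto simp: mult_less_0_iff)
        obtain A3 where A3: "base_change n (B i) A3 gs" "det (A1 * A) * det A3 = 1"
          using base_change_sym[OF AA(1) gs(2)] AA(2) by auto
        have "det (A1 * A) * det A3 > 0" using A3(2) by simp
        then have "det A3 < 0" using AA(2) by (auto simp: zero_less_mult_iff)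
        then have "det (A3 * A2) < 0"
          using det_base_change_trans[OF A3(1) A2(1)] A2(2) by (simp add: mult_less_0_iff)
        then show ?thesis using base_change_trans[OF A3(1) A2(1)] True by auto
      next
        case False
        then have "G i = H i" using eq by (simp add: reverse_odd_def)
        then show ?thesis using i H(1) False by (auto simp: orientation_def)
      qed
    qed simp
  qed
qed

lemma oriented_sum_standardD:
  assumes eq: "oriented_sum n (oriented_sum n V1 V2) V3 = standard_orientation n"
  obtains bs cs ds where "bs \<in> V1" "cs \<in> V2" "ds \<in> V3"
    "length bs + length cs + length ds = n" "det (mat_of_cols n (bs @ cs @ ds)) > 0"
proof -
  have "unit_vecs n \<in> standard_orientation n"
    unfolding standard_orientation_def orientation_def
    using base_change_refl[OF unit_vecs_carrier, of n] by (auto intro!: exI[of _ "1\<^sub>m _"])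
  then obtain es ds where es: "es \<in> oriented_sum n V1 V2" "ds \<in> V3" "unit_vecs n \<in> orientation n (es @ ds)"
    unfolding eq[symmetric] by (auto simp: oriented_sum_def)
  then obtain bs cs A where bs: "bs \<in> V1" "cs \<in> V2" "base_change n (bs @ cs) A es" "det A > 0"
    by (auto simp: oriented_sum_def orientation_def)
  obtain B where B: "base_change n (es @ ds) B (unit_vecs n)" "det B > 0"
    using es(3) by (auto simp: orientation_def)
  have len: "length es + length ds = n"
    using length_base_change[OF B(1)] by (simp add: unit_vecs_def)
  have len': "length bs + length cs = length es" using length_base_change[OF bs(3)] by simp
  have "det (mat_of_cols n ([] @ unit_vecs n @ [])) = det B * det (mat_of_cols n ([] @ (es @ ds) @ []))"
    using len by (intro det_mat_of_cols_base_change[OF B(1)]) simp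
  then have "det B * det (mat_of_cols n (es @ ds)) = 1" by (simp add: mat_of_cols_unit_vecs)
  then have "det (mat_of_cols n (es @ ds)) > 0" using B(2) zero_less_mult_pos[of "det B" "det (mat_of_cols n (es @ ds))"] by simp
  moreover have "det (mat_of_cols n ([] @ es @ ds)) = det A * det (mat_of_cols n ([] @ (bs @ cs) @ ds))"
    using len len' by (intro det_mat_of_cols_base_change[OF bs(3)]) simp
  ultimately have "det (mat_of_cols n (bs @ cs @ ds)) > 0" using bs(4) by (simp add: zero_less_mult_iff)
  then show ?thesis using that bs es len len' by simp
qed

text \<open>
  Hyperconvexity only provides some lifts and some bases of their spaces. Passing to prescribed bases multiplies
  the determinants by transition determinants, whose signs are known up to one choice for each flag.
\<close>

lemma hyperconvex_signs:
  assumes n: "n > 0" and F: "F1 \<in> Flag\<^sup>+ n" "F2 \<in> Flag\<^sup>+ n" "F3 \<in> Flag\<^sup>+ n"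
    and hyp: "hyperconvex n F1 F2 F3"
    and B: "basis_lift n B1 F1" "basis_lift n B2 F2" "basis_lift n B3 F3"
  obtains s1 s2 s3 :: real where "s1 = 1 \<or> s1 = -1" "s2 = 1 \<or> s2 = -1" "s3 = 1 \<or> s3 = -1"
    "\<And>i j l. i < n \<Longrightarrow> j < n \<Longrightarrow> l < n \<Longrightarrow> i + j + l = n \<Longrightarrow>
       s1 ^ i * s2 ^ j * s3 ^ l * det (mat_of_cols n (B1 i @ B2 j @ B3 l)) > 0"
proof -
  obtain G1 G2 G3 where G: "G1 \<in> F1" "G2 \<in> F2" "G3 \<in> F3"
    and sum: "\<And>i j l. i \<le> n - 1 \<Longrightarrow> j \<le> n - 1 \<Longrightarrow> l \<le> n - 1 \<Longrightarrow> i + j + l = n \<Longrightarrow>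
       oriented_sum n (oriented_sum n (G1 i) (G2 j)) (G3 l) = standard_orientation n"
    using hyp unfolding hyperconvex_def by blast
  obtain s1 :: real where s1: "s1 = 1 \<or> s1 = -1"
    "\<And>i bs. i < n \<Longrightarrow> bs \<in> G1 i \<Longrightarrow> \<exists>A. base_change n (B1 i) A bs \<and> s1 ^ i * det A > 0"
    using lift_sign[OF F(1) G(1) B(1)] by blast
  obtain s2 :: real where s2: "s2 = 1 \<or> s2 = -1"
    "\<And>i bs. i < n \<Longrightarrow> bs \<in> G2 i \<Longrightarrow> \<exists>A. base_change n (B2 i) A bs \<and> s2 ^ i * det A > 0"
    using lift_sign[OF F(2) G(2) B(2)] by blast
  obtain s3 :: real where s3: "s3 = 1 \<or> s3 = -1"
    "\<And>i bs. i < n \<Longrightarrow> bs \<in> G3 i \<Longrightarrow> \<exists>A. base_change n (B3 i) A bs \<and> s3 ^ i * det A > 0"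
    using lift_sign[OF F(3) G(3) B(3)] by blast
  show ?thesis
  proof (rule that[OF s1(1) s2(1) s3(1)])
    fix i j l assume lt: "i < n" "j < n" "l < n" and n_eq: "i + j + l = n"
    have "oriented_sum n (oriented_sum n (G1 i) (G2 j)) (G3 l) = standard_orientation n"
      using lt n_eq by (intro sum) auto
    then obtain bs cs ds where bs: "bs \<in> G1 i" "cs \<in> G2 j" "ds \<in> G3 l"
      "det (mat_of_cols n (bs @ cs @ ds)) > 0"
      using oriented_sum_standardD by blast
    obtain A1 where A1: "base_change n (B1 i) A1 bs" "s1 ^ i * det A1 > 0" using s1(2) lt bs by blast
    obtain A2 where A2: "base_change n (B2 j) A2 cs" "s2 ^ j * det A2 > 0" using s2(2) lt bs by blast
    obtain A3 where A3: "base_change n (B3 l) A3 ds" "s3 ^ l * det A3 > 0" using s3(2) lt bs by blast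
    have len: "length (B1 i) = i" "length (B2 j) = j" "length (B3 l) = l"
      using B lt by (auto simp: basis_lift_def)
    note len' = len length_base_change[OF A1(1)] length_base_change[OF A2(1)]
    let ?d = "\<lambda>xs. det (mat_of_cols n xs)"
    have "?d (bs @ cs @ ds) = det A1 * ?d (B1 i @ cs @ ds)"
      using det_mat_of_cols_base_change[OF A1(1), of "[]" "cs @ ds"] len' length_base_change[OF A3(1)] n_eq
      by simp
    also have "?d (B1 i @ cs @ ds) = det A2 * ?d (B1 i @ B2 j @ ds)"
      using det_mat_of_cols_base_change[OF A2(1), of "B1 i" ds] len' length_base_change[OF A3(1)] n_eq
      by simp
    also have "?d (B1 i @ B2 j @ ds) = det A3 * ?d (B1 i @ B2 j @ B3 l)"
      using det_mat_of_cols_base_change[OF A3(1), of "B1 i @ B2 j" "[]"] len' n_eq by simp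
    finally have d: "?d (bs @ cs @ ds) = det A1 * (det A2 * (det A3 * ?d (B1 i @ B2 j @ B3 l)))" .
    define D where "D = ?d (B1 i @ B2 j @ B3 l)"
    have "(s1 ^ i)\<^sup>2 = 1" "(s2 ^ j)\<^sup>2 = 1" "(s3 ^ l)\<^sup>2 = 1"
      using s1(1) s2(1) s3(1) by (auto simp flip: power_mult)
    then have "?d (bs @ cs @ ds)
      = (s1 ^ i)\<^sup>2 * (s2 ^ j)\<^sup>2 * (s3 ^ l)\<^sup>2 * (det A1 * (det A2 * (det A3 * D)))"
      using d by (simp add: D_def)
    also have "\<dots>
      = (s1 ^ i * det A1) * ((s2 ^ j * det A2) * ((s3 ^ l * det A3) * (s1 ^ i * s2 ^ j * s3 ^ l * D)))"
      by (simp add: power2_eq_square ac_simps)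
    finally have "0 < (s1 ^ i * det A1) * ((s2 ^ j * det A2) * ((s3 ^ l * det A3)
        * (s1 ^ i * s2 ^ j * s3 ^ l * D)))"
      using bs(4) by simp
    from zero_less_mult_pos[OF zero_less_mult_pos[OF zero_less_mult_pos[OF this A1(2)] A2(2)] A3(2)]
    show "s1 ^ i * s2 ^ j * s3 ^ l * ?d (B1 i @ B2 j @ B3 l) > 0"
      unfolding D_def .
  qed
qed

lemma adapted_basis_lift:
  assumes "adapted n E F1 F2"
  shows "basis_lift n (\<lambda>i. take i E) F1" "basis_lift n (\<lambda>i. drop (n - i) E) F2"
proof -
  have E: "E \<in> standard_orientation n" and F: "initial_flag n E \<in> F1" "final_flag n E \<in> F2"
    using assms by (auto simp: adapted_def)
  note E' = standard_orientationD[OF E]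
  show "basis_lift n (\<lambda>i. take i E) F1"
    unfolding basis_lift_def using E' F(1) set_take_subset[of _ E]
    by (auto simp: initial_flag_def intro!: bexI[OF _ F(1)])
  show "basis_lift n (\<lambda>i. drop (n - i) E) F2"
    unfolding basis_lift_def using E' F(2) set_drop_subset[of _ E]
    by (auto simp: final_flag_def intro!: bexI[OF _ F(2)])
qed

text \<open>
  For positively oriented bases \<open>E\<close> and \<open>H\<close> and even \<open>n\<close> this says that the initial and the final flag of \<open>E\<close>
  and the initial flag of \<open>H\<close> form a hyperconvex triple; \<open>\<epsilon> = -1\<close> accounts for the other lift of the third flag.
\<close>

definition positive_third_flag :: "nat \<Rightarrow> real \<Rightarrow> real vec list \<Rightarrow> real vec list \<Rightarrow> bool" where
  "positive_third_flag n \<epsilon> E H \<longleftrightarrow> (\<forall>i j l. i + j + l = n \<longrightarrow>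
     \<epsilon> ^ l * det (mat_of_cols n (take i E @ drop (n - j) E @ take l H)) > 0)"

text \<open>
  Without vectors of \<open>H\<close> the determinant is that of \<open>E\<close>, which is positive; as \<open>n\<close> is even, this forces the lifts of
  the initial and of the final flag of \<open>E\<close> to match, and only the lift of the third flag is left to
  choose.
\<close>

lemma positive_third_flagI:
  assumes n: "even n" "n > 0" and len: "length E = n" "length H = n"
    and det: "det (mat_of_cols n E) > 0" "det (mat_of_cols n H) > 0"
    and s: "s1 = 1 \<or> s1 = -1" "s2 = 1 \<or> s2 = -1" "s3 = 1 \<or> s3 = (-1::real)"
    and pos: "\<And>i j l. i < n \<Longrightarrow> j < n \<Longrightarrow> l < n \<Longrightarrow> i + j + l = n \<Longrightarrow>
      s1 ^ i * s2 ^ j * s3 ^ l * det (mat_of_cols n (take i E @ drop (n - j) E @ take l H)) > 0"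
  shows "positive_third_flag n (s1 * s3) E H"
proof -
  have n2: "1 < n" "odd (n - 1)" using n by (auto intro: Suc_lessI)
  \<comment> \<open>The decomposition \<open>n = 1 + (n - 1) + 0\<close> has two odd summands and so compares the two lifts.\<close>
  have "s1 ^ 1 * s2 ^ (n - 1) * s3 ^ 0 * det (mat_of_cols n (take 1 E @ drop (n - (n - 1)) E @ take 0 H)) > 0"
    using n2 by (intro pos) auto
  moreover have "take 1 E @ drop (n - (n - 1)) E @ take 0 H = E" using n2(1) by simp
  moreover have "s2 ^ (n - 1) = s2" using s(2) n2(2) by auto
  ultimately have "s1 * s2 > 0" using det(1) by (auto simp: zero_less_mult_iff)
  then have s12: "s2 = s1" using s by auto
  have sn: "s1 ^ n = 1" "s3 ^ n = 1" using s n by auto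
  show ?thesis
    unfolding positive_third_flag_def
  proof (intro allI impI)
    fix i j l assume n_eq: "i + j + l = n"
    consider "i = n" | "j = n" | "l = n" | "i < n" "j < n" "l < n" using n_eq by linarith
    then show "(s1 * s3) ^ l * det (mat_of_cols n (take i E @ drop (n - j) E @ take l H)) > 0"
    proof cases
      case 4
      have "s1 ^ (i + j) = s1 ^ l"
      proof -
        have "even (i + j) \<longleftrightarrow> even l" using n(1) n_eq by (metis even_add)
        then show ?thesis using s(1) by (cases "even l") auto
      qed
      then show ?thesis using pos[OF 4 n_eq] by (simp add: s12 power_add power_mult_distrib)
    qed (use n_eq len det sn in \<open>auto simp: power_mult_distrib\<close>)
  qed
qed

text \<open>
  In coordinates with respect to \<open>E\<close>, and after moving the vectors of \<open>H\<close> into the gap between the initial and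
  the final segment of \<open>E\<close>, the matrix of the determinant is the identity outside of the \<open>j\<close> columns of \<open>C\<close>,
  so its determinant is the minor of \<open>C\<close> on the rows of the gap.
\<close>

lemma positive_third_flag_minors:
  assumes pos: "positive_third_flag n \<epsilon> E H" and len: "length E = n" "length H = n"
    and E: "det (mat_of_cols n E) > 0"
    and C: "C \<in> carrier_mat n n" "mat_of_cols n E * C = mat_of_cols n H"
  shows "eliminated_columns n \<epsilon> 0 C"
proof -
  have P: "mat_of_cols n E \<in> carrier_mat n n" using mat_of_cols_carrier(1)[of n E] len by simp
  have "\<epsilon> ^ j * (-1) ^ (j * (n - p - j)) * contiguous_minor C p 0 j > 0" if pj: "p + j \<le> n" for p j
  proof -
    define q where "q = n - p - j"
    define T where "T = four_block_mat (mat j j (\<lambda>(r, c). C $$ (p + r, c))) (0\<^sub>m j q)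
      (mat q j (\<lambda>(r, c). C $$ (p + j + r, c))) (1\<^sub>m q)"
    define K where "K = four_block_mat (1\<^sub>m p) (mat p (j + q) (\<lambda>(r, c). if c < j then C $$ (r, c) else 0))
      (0\<^sub>m (j + q) p) T"
    have T: "T \<in> carrier_mat (j + q) (j + q)" by (simp add: T_def)
    have "K \<in> carrier_mat (p + (j + q)) (p + (j + q))" using T by (simp add: K_def)
    then have K: "K \<in> carrier_mat n n" using pj by (simp add: q_def)
    have "det T = contiguous_minor C p 0 j"
      unfolding T_def by (subst det_four_block_mat_upper_right_zero[of _ j _ q]) (auto simp: contiguous_minor_def)
    then have detK: "det K = contiguous_minor C p 0 j"
      unfolding K_def by (subst det_four_block_mat_lower_left_zero[OF one_carrier_mat _ refl T]) auto
    have colK: "col K c = (if p \<le> c \<and> c < p + j then col C (c - p) else unit_vec n c)" if c: "c < n" for c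
    proof (rule eq_vecI)
      fix r assume "r < dim_vec (if p \<le> c \<and> c < p + j then col C (c - p) else unit_vec n c)"
      then have r: "r < n" using C(1) by (auto split: if_splits)
      then have "K $$ (r, c) = (if p \<le> c \<and> c < p + j then C $$ (r, c - p) else if r = c then 1 else 0)"
        using c pj unfolding K_def T_def q_def by auto
      then show "col K c $ r = (if p \<le> c \<and> c < p + j then col C (c - p) else unit_vec n c) $ r"
        using r c K C(1) by auto
    qed (use K C(1) in auto)
    let ?L = "take p E @ take j H @ drop (p + j) E"
    have lenL: "length ?L = n" using len pj by simp
    have "mat_of_cols n ?L = mat_of_cols n E * K"
    proof (rule eq_matI)
      fix r c assume "r < dim_row (mat_of_cols n E * K)" "c < dim_col (mat_of_cols n E * K)"
      then have rc: "r < n" "c < n" using K by auto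
      have "(mat_of_cols n E * K) $$ (r, c) = row (mat_of_cols n E) r \<bullet> col K c"
        using rc K by simp
      also have "\<dots> = ?L ! c $ r"
      proof (cases "p \<le> c \<and> c < p + j")
        case True
        then have "row (mat_of_cols n E) r \<bullet> col K c = (mat_of_cols n E * C) $$ (r, c - p)"
          using colK[OF rc(2)] rc C(1) by simp
        also have "\<dots> = H ! (c - p) $ r" unfolding C(2) using rc len by (simp add: mat_of_cols_index)
        finally show ?thesis using True rc len by (auto simp: nth_append)
      next
        case False
        then have "row (mat_of_cols n E) r \<bullet> col K c = row (mat_of_cols n E) r $ c"
          using colK[OF rc(2)] rc P by (auto intro: scalar_prod_right_unit)
        also have "\<dots> = E ! c $ r" using rc len by (simp add: mat_of_cols_index)
        finally show ?thesis using False rc len pj by (auto simp: nth_append)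
      qed
      finally show "mat_of_cols n ?L $$ (r, c) = (mat_of_cols n E * K) $$ (r, c)"
        using rc lenL by (simp add: mat_of_cols_index)
    qed (use K lenL in auto)
    then have 1: "det (mat_of_cols n ?L) = det (mat_of_cols n E) * contiguous_minor C p 0 j"
      using det_mult[OF P K] detK by simp
    have "det (mat_of_cols n (take p E @ drop (p + j) E @ take j H)) = (-1) ^ (q * j) * det (mat_of_cols n ?L)"
      using det_mat_of_cols_swap[of "take p E" "drop (p + j) E" "take j H" n] len pj by (simp add: q_def)
    moreover have "\<epsilon> ^ j * det (mat_of_cols n (take p E @ drop (n - q) E @ take j H)) > 0"
      using pj by (intro pos[unfolded positive_third_flag_def, rule_format]) (simp add: q_def)
    moreover have "n - q = p + j" using pj by (simp add: q_def)
    ultimately have "det (mat_of_cols n E) * (\<epsilon> ^ j * (-1) ^ (j * q) * contiguous_minor C p 0 j) > 0"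
      using 1 by (simp add: ac_simps)
    then show ?thesis using E unfolding q_def by (metis zero_less_mult_pos)
  qed
  then show ?thesis using C(1) by (simp add: eliminated_columns_def)
qed

section \<open>Disjointness of the halfspaces\<close>

theorem theorem5p6:
  fixes n k :: nat
    and F1 F2 F3 F4 :: "oriented_flag set"
  assumes "n = 2 * k"
    and "F1 \<in> Flag\<^sup>+ n" and "F2 \<in> Flag\<^sup>+ n" and "F3 \<in> Flag\<^sup>+ n" and "F4 \<in> Flag\<^sup>+ n"
    and "cyclically_ordered n F1 F2 F3 F4"
  shows "halfspace n F1 F2 \<inter> halfspace n F3 F4 = {}"
proof (rule ccontr)
  assume "halfspace n F1 F2 \<inter> halfspace n F3 F4 \<noteq> {}"
  then obtain v w E E' where v: "v \<in> carrier_vec n" "v \<noteq> 0\<^sub>v n"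
    and w: "w \<in> carrier_vec n" "projective_class v = projective_class w"
    and E: "adapted n E F1 F2" "S_plus n E v \<le> n div 2 - 1"
    and E': "adapted n E' F3 F4" "S_plus n E' w \<le> n div 2 - 1"
    unfolding halfspace_def by blast
  have n: "even n" "n > 0"
  proof -
    show "even n" using assms(1) by simp
    show "n > 0"
    proof (rule ccontr)
      assume "\<not> n > 0"
      then have "v = 0\<^sub>v n" using v(1) by (intro eq_vecI) auto
      then show False using v(2) by simp
    qed
  qed
  have "v \<in> projective_class v"
    unfolding projective_class_def using v(1) by (auto intro!: exI[of _ 1])
  then obtain c where c: "v = c \<cdot>\<^sub>v w" "c \<noteq> 0" unfolding w(2) by (auto simp: projective_class_def)
  have F: "hyperconvex n F1 F2 F3" "hyperconvex n F1 F3 F4"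
  proof -
    have all: "\<And>i j l. i < j \<Longrightarrow> j < l \<Longrightarrow> l < 4 \<Longrightarrow>
        hyperconvex n ([F1, F2, F3, F4] ! i) ([F1, F2, F3, F4] ! j) ([F1, F2, F3, F4] ! l)"
      using assms(6) by (simp add: cyclically_ordered_def Let_def)
    show "hyperconvex n F1 F2 F3" using all[of 0 1 2] by simp
    show "hyperconvex n F1 F3 F4" using all[of 0 2 3] by (simp add: numeral_3_eq_3)
  qed
  have std: "E \<in> standard_orientation n" "E' \<in> standard_orientation n"
    using E(1) E'(1) by (auto simp: adapted_def)
  note e = standard_orientationD[OF std(1)] and e' = standard_orientationD[OF std(2)]
  note lift = adapted_basis_lift[OF E(1)] and lift' = adapted_basis_lift[OF E'(1)]
  let ?P = "mat_of_cols n E" and ?P' = "mat_of_cols n E'"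
  obtain s1 s2 s3 :: real where s: "s1 = 1 \<or> s1 = -1" "s2 = 1 \<or> s2 = -1" "s3 = 1 \<or> s3 = -1"
    "\<And>i j l. i < n \<Longrightarrow> j < n \<Longrightarrow> l < n \<Longrightarrow> i + j + l = n \<Longrightarrow>
       s1 ^ i * s2 ^ j * s3 ^ l * det (mat_of_cols n (take i E @ drop (n - j) E @ take l E')) > 0"
    using hyperconvex_signs[OF n(2) assms(2,3,4) F(1) lift lift'(1)] by blast
  have pos: "positive_third_flag n (s1 * s3) E E'"
    using e e' s by (intro positive_third_flagI[OF n, where ?s2.0 = s2]) auto
  obtain r1 r2 r3 :: real where r: "r1 = 1 \<or> r1 = -1" "r2 = 1 \<or> r2 = -1" "r3 = 1 \<or> r3 = -1"
    "\<And>i j l. i < n \<Longrightarrow> j < n \<Longrightarrow> l < n \<Longrightarrow> i + j + l = n \<Longrightarrow>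
       r1 ^ i * r2 ^ j * r3 ^ l * det (mat_of_cols n (take i E @ take j E' @ drop (n - l) E')) > 0"
    using hyperconvex_signs[OF n(2) assms(2,4,5) F(2) lift(1) lift'] by blast
  \<comment> \<open>Rotating \<open>(F1, F3, F4)\<close> to \<open>(F3, F4, F1)\<close> moves \<open>l\<close> vectors past the other \<open>n - l\<close> ones. As \<open>n\<close> is
      even, this contributes the sign \<open>(-1)\<^sup>l\<close>, that is, replaces the lift of \<open>F1\<close> by the other one.\<close>
  have pos': "positive_third_flag n (r2 * (- r1)) E' E"
  proof (rule positive_third_flagI[OF n, where ?s2.0 = r3])
    fix i j l assume lt: "i < n" "j < n" "l < n" and n_eq: "i + j + l = n"
    have "det (mat_of_cols n ([] @ take l E @ (take i E' @ drop (n - j) E')))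
      = (-1) ^ (l * (i + j)) * det (mat_of_cols n ([] @ (take i E' @ drop (n - j) E') @ take l E))"
      using det_mat_of_cols_swap[of "[]" "take l E" "take i E' @ drop (n - j) E'" n] e e' lt n_eq by simp
    moreover have "(-1 :: real) ^ (l * (i + j)) = (-1) ^ l"
    proof -
      have "even (i + j) \<longleftrightarrow> even l" using n(1) n_eq by (metis even_add)
      then show ?thesis by (cases "even l") auto
    qed
    moreover have "r1 ^ l * r2 ^ i * r3 ^ j * det (mat_of_cols n (take l E @ take i E' @ drop (n - j) E')) > 0"
      using lt n_eq by (intro r(4)) auto
    ultimately show "r2 ^ i * r3 ^ j * (- r1) ^ l
        * det (mat_of_cols n (take i E' @ drop (n - j) E' @ take l E)) > 0"
      by (simp add: power_minus[of r1 l] ac_simps)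
  qed (use e e' r in auto)
  obtain Q where Q: "Q \<in> carrier_mat n n" "?P * Q = 1\<^sub>m n" "Q * ?P = 1\<^sub>m n"
    using obtain_inverse_mat[OF e(3)] e(4) by auto
  obtain Q' where Q': "Q' \<in> carrier_mat n n" "?P' * Q' = 1\<^sub>m n" "Q' * ?P' = 1\<^sub>m n"
    using obtain_inverse_mat[OF e'(3)] e'(4) by auto
  have C: "eliminated_columns n (s1 * s3) 0 (Q * ?P')"
  proof (rule positive_third_flag_minors[OF pos e(1) e'(1) e(4)])
    show "?P * (Q * ?P') = ?P'" using assoc_mult_mat[OF e(3) Q(1) e'(3)] Q(2) e'(3) by simp
  qed (use Q(1) e'(3) in auto)
  have C': "eliminated_columns n (r2 * (- r1)) 0 (Q' * ?P)"
  proof (rule positive_third_flag_minors[OF pos' e'(1) e(1) e'(4)])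
    show "?P' * (Q' * ?P) = ?P" using assoc_mult_mat[OF e'(3) Q'(1) e(3)] Q'(2) e(3) by simp
  qed (use Q'(1) e(3) in auto)
  have "Q * ?P' * (Q' * ?P) = Q * (?P' * Q') * ?P"
    using Q(1) Q'(1) e(3) e'(3) by (simp add: assoc_mult_mat[of _ n n _ n _ n])
  then have inv: "Q * ?P' * (Q' * ?P) = 1\<^sub>m n" using Q Q'(2) by simp
  define a where "a = Q *\<^sub>v v"
  define b where "b = Q' *\<^sub>v w"
  have ab: "a \<in> carrier_vec n" "b \<in> carrier_vec n" using Q(1) Q'(1) v(1) w(1) by (auto simp: a_def b_def)
  have Pa: "?P *\<^sub>v a = v" unfolding a_def using assoc_mult_mat_vec[OF e(3) Q(1) v(1)] Q(2) v(1) by simp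
  have Pb: "?P' *\<^sub>v b = w" unfolding b_def using assoc_mult_mat_vec[OF e'(3) Q'(1) w(1)] Q'(2) w(1) by simp
  have "Q * ?P' *\<^sub>v (c \<cdot>\<^sub>v b) = Q *\<^sub>v (c \<cdot>\<^sub>v (?P' *\<^sub>v b))"
    using assoc_mult_mat_vec[OF Q(1) e'(3), of "c \<cdot>\<^sub>v b"] mult_mat_vec[OF e'(3) ab(2)] ab(2) by simp
  then have "a = Q * ?P' *\<^sub>v (c \<cdot>\<^sub>v b)" unfolding Pb a_def c(1) by simp
  then have "n - 1 \<le> max_sign_changes (list_of_vec a) + max_sign_changes (list_of_vec b)"
    by (rule sign_changes_complementary[OF C C' inv ab(2) _ c(2)])
  also have "\<dots> = S_plus n E v + S_plus n E' w"
    using coordinates_eq[OF e(1) _ ab(1) Pa] coordinates_eq[OF e'(1) _ ab(2) Pb] e(4) e'(4)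
    by (simp add: S_plus_def max_sign_changes_def)
  finally show False using E(2) E'(2) n assms(1) by simp
qed

end
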